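(* Let $\pi:(M,g,J)\to(N,g_N)$ be a (proper) bi-slant submersion from a Kähler manifold onto a Riemannian manifold. Then the slant distribution $\mathcal D^{\theta_1}$ defines a totally geodesic foliation on $\ker\pi_*$ if and only if $$g\big(\mathcal T_{PU}FY-\mathcal T_U FPY+\mathcal A_{FU}FY,\;X\big)=0,$$ where $X,Y\in\mathcal D^{\theta_1}$ and $U\in\mathcal D^{\theta_2}$.
   Context: A Riemannian submersion $\pi:(M,g)\to(N,g_N)$, $\dim M>\dim N$, is a surjective map of maximal rank such that $\pi_*$ restricted to $(\ker\pi_* )^\perp$ is a linear isometry. Vector fields in $\ker\pi_*$ are vertical, those in $(\ker\pi_* )^\perp$ horizontal; $\mathcal V,\mathcal H$ are the projections onto $\ker\pi_*$ and $(\ker\pi_* )^\perp$. A vector field on $M$ is basic if it is horizontal and $\pi$-related to a vector field on $N$. Standing convention: all horizontal vector fields are assumed to be basic. $\nabla$ is the Levi-Civita connection of $g$. O'Neill's tensors are $\mathcal T_E G=\mathcal V\nabla_{\mathcal V E}\mathcal H G+\mathcal H\nabla_{\mathcal V E}\mathcal V G$ and $\mathcal A_E G=\mathcal V\nabla_{\mathcal H E}\mathcal H G+\mathcal H\nabla_{\mathcal H E}\mathcal V G$. For vertical $V,W$, $\hat\nabla_V W=\mathcal V\nabla_V W$. Kähler means $J^2=-I$, $g(JX,JY)=g(X,Y)$, $\nabla J=0$. For $V\in\ker\pi_*$ write $JV=PV+FV$ with $PV$ vertical and $FV$ horizontal. A distribution $\mathcal D$ is slant with slant angle $\theta$ if for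 every point $p$ and every nonzero $X\in\mathcal D_p$ the angle between $JX$ and $\mathcal D_p$ equals the constant $\theta$. A Riemannian submersion $\pi$ from a Kähler manifold is a bi-slant submersion if there are two slant distributions $\mathcal D^{\theta_1},\mathcal D^{\theta_2}\subset\ker\pi_*$, with slant angles $\theta_1$ and $\theta_2$ respectively, such that $\ker\pi_*=\mathcal D^{\theta_1}\oplus\mathcal D^{\theta_2}$. It is proper if each slant angle is different from $0$ and $\pi/2$. $\mathcal D^{\theta_1}$ defines a totally geodesic foliation on $\ker\pi_*$ if $\hat\nabla_X Y\in\mathcal D^{\theta_1}$ for all $X,Y\in\mathcal D^{\theta_1}$.
   Formalization: Assumes that the two slant distributions are orthogonal and that J D^{θ1} is orthogonal to D^{θ2} (the claim fails without the latter); "all horizontal fields are basic" is read as: each vector of D^{θ1} extends to a section Y of D^{θ1} with FY basic near the point. *)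

theory Defs
  imports "HOL-Analysis.Analysis"
begin

section \<open>Smooth manifolds and tangent vectors\<close>

text \<open>\<open>Ck_on\<close> and \<open>smooth_on\<close> are only used on open sets.\<close>

primrec Ck_on :: "nat \<Rightarrow> 'a::euclidean_space set \<Rightarrow> ('a \<Rightarrow> 'b::real_normed_vector) \<Rightarrow> bool" where
  "Ck_on 0 S f \<longleftrightarrow> continuous_on S f"
| "Ck_on (Suc k) S f \<longleftrightarrow>
     f differentiable_on S \<and> (\<forall>v. Ck_on k S (\<lambda>x. frechet_derivative f (at x) v))"

definition smooth_on :: "'a::euclidean_space set \<Rightarrow> ('a \<Rightarrow> 'b::real_normed_vector) \<Rightarrow> bool" where
  "smooth_on S f \<longleftrightarrow> (\<forall>k. Ck_on k S f)"

text \<open>A chart \<open>(U, x)\<close> consists of its domain and its coordinate map. The points of a manifold are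
  all elements of the type \<open>'m\<close>, and the dimension is \<open>DIM('e)\<close>.\<close>

type_synonym ('m, 'e) chart = "'m set \<times> ('m \<Rightarrow> 'e)"

definition cinv :: "('m, 'e) chart \<Rightarrow> 'e \<Rightarrow> 'm" where
  "cinv c = inv_into (fst c) (snd c)"

definition is_chart :: "('m::topological_space, 'e::euclidean_space) chart \<Rightarrow> bool" where
  "is_chart c \<longleftrightarrow> open (fst c) \<and> open (snd c ` fst c) \<and>
     homeomorphism (fst c) (snd c ` fst c) (snd c) (cinv c)"

definition smooth_atlas ::
  "('m::{t2_space, second_countable_topology}, 'e::euclidean_space) chart set \<Rightarrow> bool" where
  "smooth_atlas A \<longleftrightarrow>
     (\<forall>c\<in>A. is_chart c) \<and> (\<Union>c\<in>A. fst c) = UNIV \<and>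
     (\<forall>c\<in>A. \<forall>d\<in>A. smooth_on (snd c ` (fst c \<inter> fst d)) (snd d \<circ> cinv c))"

text \<open>The tangent space at \<open>p\<close> is identified with \<open>'e\<close> by the differential of one chosen chart
  \<open>chart_at A p\<close> around \<open>p\<close>: a tangent vector at \<open>p\<close> is represented by its components in that
  chart. The choice varies arbitrarily with \<open>p\<close>, so smoothness of a field is never read off from
  these representatives directly; it is always tested on the components \<open>coord A c\<close> in a fixed
  chart \<open>c\<close>.\<close>

definition chart_at :: "('m, 'e) chart set \<Rightarrow> 'm \<Rightarrow> ('m, 'e) chart" where
  "chart_at A p = (SOME c. c \<in> A \<and> p \<in> fst c)"

text \<open>The derivative \<open>dh\<^sub>p(v)\<close> of a function \<open>h\<close> with values in a vector space; it depends
  only on the germ of \<open>h\<close> at \<open>p\<close>. For real-valued \<open>h\<close> and a vector field \<open>X\<close>,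
  \<open>\<lambda>p. pdiff A h p (X p)\<close> is the function \<open>X h\<close>.\<close>

definition pdiff ::
  "('m, 'e::euclidean_space) chart set \<Rightarrow> ('m \<Rightarrow> 'b::real_normed_vector) \<Rightarrow> 'm \<Rightarrow> 'e \<Rightarrow> 'b" where
  "pdiff A h p v = frechet_derivative (h \<circ> cinv (chart_at A p)) (at (snd (chart_at A p) p)) v"

text \<open>Components of a tangent vector in the chart \<open>c\<close>, and conversely the tangent vector with
  prescribed components in \<open>c\<close>.\<close>

definition coord ::
  "('m, 'e::euclidean_space) chart set \<Rightarrow> ('m, 'e) chart \<Rightarrow> 'm \<Rightarrow> 'e \<Rightarrow> 'e" where
  "coord A c p v = pdiff A (snd c) p v"

definition cvec ::
  "('m, 'e::euclidean_space) chart set \<Rightarrow> ('m, 'e) chart \<Rightarrow> 'm \<Rightarrow> 'e \<Rightarrow> 'e" where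
  "cvec A c p u = frechet_derivative (snd (chart_at A p) \<circ> cinv c) (at (snd c p)) u"

definition smooth_fun_on ::
  "('m, 'e::euclidean_space) chart set \<Rightarrow> 'm set \<Rightarrow> ('m \<Rightarrow> real) \<Rightarrow> bool" where
  "smooth_fun_on A W f \<longleftrightarrow> (\<forall>c\<in>A. smooth_on (snd c ` (fst c \<inter> W)) (f \<circ> cinv c))"

definition smooth_field ::
  "('m, 'e::euclidean_space) chart set \<Rightarrow> ('m \<Rightarrow> 'e) \<Rightarrow> bool" where
  "smooth_field A X \<longleftrightarrow>
     (\<forall>c\<in>A. smooth_on (snd c ` fst c) (\<lambda>x. coord A c (cinv c x) (X (cinv c x))))"

definition smooth_endo ::
  "('m, 'e::euclidean_space) chart set \<Rightarrow> ('m \<Rightarrow> 'e \<Rightarrow> 'e) \<Rightarrow> bool" where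
  "smooth_endo A J \<longleftrightarrow> (\<forall>p. linear (J p)) \<and>
     (\<forall>c\<in>A. \<forall>u. smooth_on (snd c ` fst c)
        (\<lambda>x. coord A c (cinv c x) (J (cinv c x) (cvec A c (cinv c x) u))))"

definition smooth_mapping ::
  "('m::topological_space, 'e::euclidean_space) chart set \<Rightarrow>
   ('n::topological_space, 'f::euclidean_space) chart set \<Rightarrow> ('m \<Rightarrow> 'n) \<Rightarrow> bool" where
  "smooth_mapping A B \<pi> \<longleftrightarrow> continuous_on UNIV \<pi> \<and>
     (\<forall>c\<in>A. \<forall>d\<in>B. smooth_on (snd c ` (fst c \<inter> \<pi> -` fst d)) (snd d \<circ> \<pi> \<circ> cinv c))"

definition push ::
  "('m, 'e::euclidean_space) chart set \<Rightarrow> ('n, 'f::euclidean_space) chart set \<Rightarrow>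
   ('m \<Rightarrow> 'n) \<Rightarrow> 'm \<Rightarrow> 'e \<Rightarrow> 'f" where
  "push A B \<pi> p v = pdiff A (snd (chart_at B (\<pi> p)) \<circ> \<pi>) p v"

section \<open>Riemannian and Kaehler manifolds\<close>

record ('m, 'e) riem =
  atlas :: "('m, 'e) chart set"
  rmetric :: "'m \<Rightarrow> 'e \<Rightarrow> 'e \<Rightarrow> real"

definition riemannian_manifold ::
  "('m::{t2_space, second_countable_topology}, 'e::euclidean_space) riem \<Rightarrow> bool" where
  "riemannian_manifold M \<longleftrightarrow> smooth_atlas (atlas M) \<and>
     (\<forall>p. bilinear (rmetric M p) \<and>
          (\<forall>v w. rmetric M p v w = rmetric M p w v) \<and>
          (\<forall>v. v \<noteq> 0 \<longrightarrow> rmetric M p v v > 0)) \<and>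
     (\<forall>c\<in>atlas M. \<forall>u v. smooth_on (snd c ` fst c)
        (\<lambda>x. rmetric M (cinv c x) (cvec (atlas M) c (cinv c x) u) (cvec (atlas M) c (cinv c x) v)))"

text \<open>The value of \<open>nabla\<close> on non-smooth arguments is unconstrained. Torsion-freeness
  \<open>\<nabla>\<^sub>X Y - \<nabla>\<^sub>Y X = [X, Y]\<close> is expressed by the action on locally defined smooth functions.\<close>

definition levi_civita ::
  "('m::{t2_space, second_countable_topology}, 'e::euclidean_space) riem \<Rightarrow>
   (('m \<Rightarrow> 'e) \<Rightarrow> ('m \<Rightarrow> 'e) \<Rightarrow> ('m \<Rightarrow> 'e)) \<Rightarrow> bool" where
  "levi_civita M nabla \<longleftrightarrow>
     (\<forall>X Y. smooth_field (atlas M) X \<longrightarrow> smooth_field (atlas M) Y \<longrightarrow>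
        smooth_field (atlas M) (nabla X Y)) \<and>
     (\<forall>X Y Z. smooth_field (atlas M) X \<longrightarrow> smooth_field (atlas M) Y \<longrightarrow>
        smooth_field (atlas M) Z \<longrightarrow>
        (\<forall>p. nabla (\<lambda>q. X q + Y q) Z p = nabla X Z p + nabla Y Z p \<and>
             nabla Z (\<lambda>q. X q + Y q) p = nabla Z X p + nabla Z Y p)) \<and>
     (\<forall>f X Y. smooth_fun_on (atlas M) UNIV f \<longrightarrow> smooth_field (atlas M) X \<longrightarrow>
        smooth_field (atlas M) Y \<longrightarrow>
        (\<forall>p. nabla (\<lambda>q. f q *\<^sub>R X q) Y p = f p *\<^sub>R nabla X Y p \<and>
             nabla X (\<lambda>q. f q *\<^sub>R Y q) p =
               pdiff (atlas M) f p (X p) *\<^sub>R Y p + f p *\<^sub>R nabla X Y p)) \<and>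
     (\<forall>X Y Z. smooth_field (atlas M) X \<longrightarrow> smooth_field (atlas M) Y \<longrightarrow>
        smooth_field (atlas M) Z \<longrightarrow>
        (\<forall>p. pdiff (atlas M) (\<lambda>q. rmetric M q (Y q) (Z q)) p (X p) =
               rmetric M p (nabla X Y p) (Z p) + rmetric M p (Y p) (nabla X Z p))) \<and>
     (\<forall>X Y. smooth_field (atlas M) X \<longrightarrow> smooth_field (atlas M) Y \<longrightarrow>
        (\<forall>W f p. open W \<longrightarrow> smooth_fun_on (atlas M) W f \<longrightarrow> p \<in> W \<longrightarrow>
           pdiff (atlas M) f p (nabla X Y p - nabla Y X p) =
             pdiff (atlas M) (\<lambda>q. pdiff (atlas M) f q (Y q)) p (X p) -
             pdiff (atlas M) (\<lambda>q. pdiff (atlas M) f q (X q)) p (Y p)))"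

definition kaehler ::
  "('m::{t2_space, second_countable_topology}, 'e::euclidean_space) riem \<Rightarrow>
   (('m \<Rightarrow> 'e) \<Rightarrow> ('m \<Rightarrow> 'e) \<Rightarrow> ('m \<Rightarrow> 'e)) \<Rightarrow> ('m \<Rightarrow> 'e \<Rightarrow> 'e) \<Rightarrow> bool" where
  "kaehler M nabla J \<longleftrightarrow> riemannian_manifold M \<and> levi_civita M nabla \<and>
     smooth_endo (atlas M) J \<and>
     (\<forall>p v. J p (J p v) = - v) \<and>
     (\<forall>p v w. rmetric M p (J p v) (J p w) = rmetric M p v w) \<and>
     (\<forall>X Y. smooth_field (atlas M) X \<longrightarrow> smooth_field (atlas M) Y \<longrightarrow>
        (\<forall>p. nabla X (\<lambda>q. J q (Y q)) p = J p (nabla X Y p)))"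

section \<open>Riemannian submersions and O'Neill's tensors\<close>

definition orth_proj :: "('e \<Rightarrow> 'e \<Rightarrow> real) \<Rightarrow> 'e set \<Rightarrow> 'e \<Rightarrow> 'e::euclidean_space" where
  "orth_proj b S v = (THE w. w \<in> S \<and> (\<forall>u\<in>S. b (v - w) u = 0))"

definition vertical ::
  "('m, 'e::euclidean_space) riem \<Rightarrow> ('n, 'f::euclidean_space) riem \<Rightarrow> ('m \<Rightarrow> 'n) \<Rightarrow> 'm \<Rightarrow> 'e set"
  where "vertical M N \<pi> p = {v. push (atlas M) (atlas N) \<pi> p v = 0}"

definition horizontal ::
  "('m, 'e::euclidean_space) riem \<Rightarrow> ('n, 'f::euclidean_space) riem \<Rightarrow> ('m \<Rightarrow> 'n) \<Rightarrow> 'm \<Rightarrow> 'e set"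
  where "horizontal M N \<pi> p = {v. \<forall>w\<in>vertical M N \<pi> p. rmetric M p v w = 0}"

definition riemannian_submersion ::
  "('m::{t2_space, second_countable_topology}, 'e::euclidean_space) riem \<Rightarrow>
   ('n::{t2_space, second_countable_topology}, 'f::euclidean_space) riem \<Rightarrow> ('m \<Rightarrow> 'n) \<Rightarrow> bool" where
  "riemannian_submersion M N \<pi> \<longleftrightarrow>
     riemannian_manifold M \<and> riemannian_manifold N \<and> DIM('f) < DIM('e) \<and>
     smooth_mapping (atlas M) (atlas N) \<pi> \<and> surj \<pi> \<and>
     (\<forall>p. surj (push (atlas M) (atlas N) \<pi> p)) \<and>
     (\<forall>p. \<forall>v\<in>horizontal M N \<pi> p. \<forall>w\<in>horizontal M N \<pi> p.
        rmetric N (\<pi> p) (push (atlas M) (atlas N) \<pi> p v) (push (atlas M) (atlas N) \<pi> p w) =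
        rmetric M p v w)"

definition ver ::
  "('m, 'e::euclidean_space) riem \<Rightarrow> ('n, 'f::euclidean_space) riem \<Rightarrow> ('m \<Rightarrow> 'n) \<Rightarrow>
   ('m \<Rightarrow> 'e) \<Rightarrow> 'm \<Rightarrow> 'e" where
  "ver M N \<pi> E p = orth_proj (rmetric M p) (vertical M N \<pi> p) (E p)"

definition hor ::
  "('m, 'e::euclidean_space) riem \<Rightarrow> ('n, 'f::euclidean_space) riem \<Rightarrow> ('m \<Rightarrow> 'n) \<Rightarrow>
   ('m \<Rightarrow> 'e) \<Rightarrow> 'm \<Rightarrow> 'e" where
  "hor M N \<pi> E p = orth_proj (rmetric M p) (horizontal M N \<pi> p) (E p)"

definition oneill_T ::
  "('m, 'e::euclidean_space) riem \<Rightarrow> ('n, 'f::euclidean_space) riem \<Rightarrow> ('m \<Rightarrow> 'n) \<Rightarrow>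
   (('m \<Rightarrow> 'e) \<Rightarrow> ('m \<Rightarrow> 'e) \<Rightarrow> ('m \<Rightarrow> 'e)) \<Rightarrow> ('m \<Rightarrow> 'e) \<Rightarrow> ('m \<Rightarrow> 'e) \<Rightarrow> 'm \<Rightarrow> 'e" where
  "oneill_T M N \<pi> nabla E G p =
     ver M N \<pi> (nabla (ver M N \<pi> E) (hor M N \<pi> G)) p +
     hor M N \<pi> (nabla (ver M N \<pi> E) (ver M N \<pi> G)) p"

definition oneill_A ::
  "('m, 'e::euclidean_space) riem \<Rightarrow> ('n, 'f::euclidean_space) riem \<Rightarrow> ('m \<Rightarrow> 'n) \<Rightarrow>
   (('m \<Rightarrow> 'e) \<Rightarrow> ('m \<Rightarrow> 'e) \<Rightarrow> ('m \<Rightarrow> 'e)) \<Rightarrow> ('m \<Rightarrow> 'e) \<Rightarrow> ('m \<Rightarrow> 'e) \<Rightarrow> 'm \<Rightarrow> 'e" where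
  "oneill_A M N \<pi> nabla E G p =
     ver M N \<pi> (nabla (hor M N \<pi> E) (hor M N \<pi> G)) p +
     hor M N \<pi> (nabla (hor M N \<pi> E) (ver M N \<pi> G)) p"

text \<open>\<open>E\<close> is a basic vector field when \<open>W = UNIV\<close>; for open \<open>W\<close> it is basic over \<open>W\<close>.\<close>

definition basic_on ::
  "('m, 'e::euclidean_space) riem \<Rightarrow> ('n, 'f::euclidean_space) riem \<Rightarrow> ('m \<Rightarrow> 'n) \<Rightarrow>
   'm set \<Rightarrow> ('m \<Rightarrow> 'e) \<Rightarrow> bool" where
  "basic_on M N \<pi> W E \<longleftrightarrow> smooth_field (atlas M) E \<and> (\<forall>q\<in>W. E q \<in> horizontal M N \<pi> q) \<and>
     (\<exists>Z. smooth_field (atlas N) Z \<and>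
        (\<forall>q\<in>W. push (atlas M) (atlas N) \<pi> q (E q) = Z (\<pi> q)))"

section \<open>Slant distributions\<close>

definition section_of ::
  "('m, 'e::euclidean_space) riem \<Rightarrow> ('m \<Rightarrow> 'e set) \<Rightarrow> ('m \<Rightarrow> 'e) \<Rightarrow> bool" where
  "section_of M D X \<longleftrightarrow> smooth_field (atlas M) X \<and> (\<forall>p. X p \<in> D p)"

text \<open>Smoothness of a distribution is the last clause. Global sections suffice, since a local
  section can be multiplied by a cut-off function.\<close>

definition distribution ::
  "('m, 'e::euclidean_space) riem \<Rightarrow> ('m \<Rightarrow> 'e set) \<Rightarrow> bool" where
  "distribution M D \<longleftrightarrow> (\<forall>p. subspace (D p)) \<and> (\<exists>k. \<forall>p. dim (D p) = k) \<and>
     (\<forall>p. \<forall>v\<in>D p. \<exists>X. section_of M D X \<and> X p = v)"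

definition angle_to :: "('e \<Rightarrow> 'e \<Rightarrow> real) \<Rightarrow> 'e::euclidean_space \<Rightarrow> 'e set \<Rightarrow> real" where
  "angle_to b v S =
     arccos (sqrt (b (orth_proj b S v) (orth_proj b S v)) / sqrt (b v v))"

definition slant ::
  "('m, 'e::euclidean_space) riem \<Rightarrow> ('m \<Rightarrow> 'e \<Rightarrow> 'e) \<Rightarrow> ('m \<Rightarrow> 'e set) \<Rightarrow> real \<Rightarrow> bool" where
  "slant M J D \<theta> \<longleftrightarrow> distribution M D \<and>
     (\<forall>p. \<forall>X\<in>D p. X \<noteq> 0 \<longrightarrow> angle_to (rmetric M p) (J p X) (D p) = \<theta>)"

text \<open>The sum \<open>ker \<pi>\<^sub>* = D1 \<oplus> D2\<close> is an orthogonal one, as usual for distributions on a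
  Riemannian manifold. The orthogonality \<open>J D1 \<bottom> D2\<close>, part of the usual notion of a bi-slant
  submanifold and equivalent to \<open>P D1 \<subseteq> D1\<close>, does not follow from these clauses and is not part of
  the definition.\<close>

definition bi_slant_submersion ::
  "('m::{t2_space, second_countable_topology}, 'e::euclidean_space) riem \<Rightarrow>
   ('n::{t2_space, second_countable_topology}, 'f::euclidean_space) riem \<Rightarrow>
   (('m \<Rightarrow> 'e) \<Rightarrow> ('m \<Rightarrow> 'e) \<Rightarrow> ('m \<Rightarrow> 'e)) \<Rightarrow> ('m \<Rightarrow> 'e \<Rightarrow> 'e) \<Rightarrow> ('m \<Rightarrow> 'n) \<Rightarrow>
   ('m \<Rightarrow> 'e set) \<Rightarrow> ('m \<Rightarrow> 'e set) \<Rightarrow> real \<Rightarrow> real \<Rightarrow> bool" where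
  "bi_slant_submersion M N nabla J \<pi> D1 D2 \<theta>\<^sub>1 \<theta>\<^sub>2 \<longleftrightarrow>
     kaehler M nabla J \<and> riemannian_submersion M N \<pi> \<and>
     slant M J D1 \<theta>\<^sub>1 \<and> slant M J D2 \<theta>\<^sub>2 \<and>
     (\<forall>p. vertical M N \<pi> p = {x + u | x u. x \<in> D1 p \<and> u \<in> D2 p}) \<and>
     (\<forall>p. \<forall>x\<in>D1 p. \<forall>u\<in>D2 p. rmetric M p x u = 0)"

definition proper_angles :: "real \<Rightarrow> real \<Rightarrow> bool" where
  "proper_angles \<theta>\<^sub>1 \<theta>\<^sub>2 \<longleftrightarrow>
     \<theta>\<^sub>1 \<noteq> 0 \<and> \<theta>\<^sub>1 \<noteq> pi / 2 \<and> \<theta>\<^sub>2 \<noteq> 0 \<and> \<theta>\<^sub>2 \<noteq> pi / 2"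

definition P_part ::
  "('m, 'e::euclidean_space) riem \<Rightarrow> ('n, 'f::euclidean_space) riem \<Rightarrow> ('m \<Rightarrow> 'n) \<Rightarrow>
   ('m \<Rightarrow> 'e \<Rightarrow> 'e) \<Rightarrow> ('m \<Rightarrow> 'e) \<Rightarrow> 'm \<Rightarrow> 'e" where
  "P_part M N \<pi> J V = ver M N \<pi> (\<lambda>q. J q (V q))"

definition F_part ::
  "('m, 'e::euclidean_space) riem \<Rightarrow> ('n, 'f::euclidean_space) riem \<Rightarrow> ('m \<Rightarrow> 'n) \<Rightarrow>
   ('m \<Rightarrow> 'e \<Rightarrow> 'e) \<Rightarrow> ('m \<Rightarrow> 'e) \<Rightarrow> 'm \<Rightarrow> 'e" where
  "F_part M N \<pi> J V = hor M N \<pi> (\<lambda>q. J q (V q))"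

definition nabla_hat ::
  "('m, 'e::euclidean_space) riem \<Rightarrow> ('n, 'f::euclidean_space) riem \<Rightarrow> ('m \<Rightarrow> 'n) \<Rightarrow>
   (('m \<Rightarrow> 'e) \<Rightarrow> ('m \<Rightarrow> 'e) \<Rightarrow> ('m \<Rightarrow> 'e)) \<Rightarrow> ('m \<Rightarrow> 'e) \<Rightarrow> ('m \<Rightarrow> 'e) \<Rightarrow> 'm \<Rightarrow> 'e" where
  "nabla_hat M N \<pi> nabla V W = ver M N \<pi> (nabla V W)"

definition totally_geodesic_on_kernel ::
  "('m, 'e::euclidean_space) riem \<Rightarrow> ('n, 'f::euclidean_space) riem \<Rightarrow> ('m \<Rightarrow> 'n) \<Rightarrow>
   (('m \<Rightarrow> 'e) \<Rightarrow> ('m \<Rightarrow> 'e) \<Rightarrow> ('m \<Rightarrow> 'e)) \<Rightarrow> ('m \<Rightarrow> 'e set) \<Rightarrow> bool" where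
  "totally_geodesic_on_kernel M N \<pi> nabla D \<longleftrightarrow>
     (\<forall>X Y. section_of M D X \<longrightarrow> section_of M D Y \<longrightarrow>
        (\<forall>p. nabla_hat M N \<pi> nabla X Y p \<in> D p))"

text \<open>The convention that horizontal fields are basic cannot be imposed on \<open>F Y\<close> for all sections
  \<open>Y\<close> of \<open>D\<close>: if \<open>F Y\<close> is basic and nonzero, then \<open>F (f Y) = f F Y\<close> is not basic unless \<open>f\<close> is
  constant along the fibres. It is imposed on enough sections: every vector of \<open>D\<close> extends to a
  section \<open>Y\<close> of \<open>D\<close> for which \<open>F Y\<close> is basic near the given point.\<close>

definition basic_convention ::
  "('m::topological_space, 'e::euclidean_space) riem \<Rightarrow> ('n, 'f::euclidean_space) riem \<Rightarrow> ('m \<Rightarrow> 'n) \<Rightarrow>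
   ('m \<Rightarrow> 'e \<Rightarrow> 'e) \<Rightarrow> ('m \<Rightarrow> 'e set) \<Rightarrow> bool" where
  "basic_convention M N \<pi> J D \<longleftrightarrow>
     (\<forall>p. \<forall>y\<in>D p. \<exists>Y W. section_of M D Y \<and> Y p = y \<and>
        open W \<and> p \<in> W \<and> basic_on M N \<pi> W (F_part M N \<pi> J Y))"

end

theory Submission
  imports Defs
begin

text \<open>Pair the three O'Neill terms with the vertical field \<open>X\<close>. Since \<open>g(FY, X) = 0\<close>, they become
  \<open>- g(FY, \<nabla>\<^bsub>PU\<^esub> X) + g(FPY, \<nabla>\<^bsub>U\<^esub> X) - g(FY, \<nabla>\<^bsub>FU\<^esub> X)\<close>, an expression that is tensorial in \<open>Y\<close>. In the
  first two terms the derivatives may be exchanged because brackets of vertical fields are vertical.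
  In the third one \<open>FY\<close> may be taken basic near the point; then \<open>g(FU, \<nabla>\<^bsub>X\<^esub> FY) = - g(FY, \<nabla>\<^bsub>FU\<^esub> X)\<close>,
  and \<open>FU \<bottom> FY\<close> turns this term into \<open>- g(FY, \<nabla>\<^bsub>X\<^esub> FU)\<close>. As \<open>PU + FU = JU\<close> and \<open>\<nabla>J = 0\<close>, the sum
  is \<open>g(J FY + FPY, \<nabla>\<^bsub>X\<^esub> U)\<close>, where \<open>J FY + FPY = - Y - P\<^sup>2 Y = - sin\<^sup>2 \<theta>\<^sub>1 Y\<close>. Hence the pairing equals
  \<open>sin\<^sup>2 \<theta>\<^sub>1 g(\<nabla>\<^bsub>X\<^esub> Y, U)\<close>. That \<open>PY\<close> and \<open>FY\<close> are smooth fields at all comes from a Gram-Schmidt process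
  along local frames of the two distributions.\<close>

section \<open>Calculus of smooth functions\<close>

lemma Ck_on_cong:
  assumes "open S" "Ck_on k S f" "\<And>x. x \<in> S \<Longrightarrow> f x = g x"
  shows "Ck_on k S g"
  using assms(2,3)
proof (induction k arbitrary: f g)
  case 0 then show ?case by (simp cong: continuous_on_cong)
next
  case (Suc k)
  \<comment> \<open>Openness of \<open>S\<close> enters here: a derivative at \<open>x\<close> sees
    only values near \<open>x\<close>, so agreement on \<open>S\<close> passes to all
    derivatives.\<close>
  have d: "frechet_derivative f (at x) = frechet_derivative g (at x)" "g differentiable (at x)" if "x \<in> S" for x
  proof -
    have "f differentiable (at x)"
      using Suc.prems(1) that assms(1) by (simp add: differentiable_on_eq_differentiable_at)
    then have fd: "(f has_derivative frechet_derivative f (at x)) (at x)"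
      by (simp add: frechet_derivative_works)
    have "(g has_derivative frechet_derivative f (at x)) (at x)"
      using has_derivative_transform_within_open[OF fd assms(1) that] Suc.prems(2) by blast
    then show "frechet_derivative f (at x) = frechet_derivative g (at x)" "g differentiable (at x)"
      using frechet_derivative_at differentiableI by blast+
  qed
  show ?case
    using Suc.IH[of "\<lambda>x. frechet_derivative f (at x) v" "\<lambda>x. frechet_derivative g (at x) v" for v]
      Suc.prems d assms(1) by (simp add: differentiable_on_eq_differentiable_at)
qed

lemma Ck_on_subset: "Ck_on k S f \<Longrightarrow> T \<subseteq> S \<Longrightarrow> Ck_on k T f"
  by (induction k arbitrary: f) (auto intro: continuous_on_subset differentiable_on_subset)

text \<open>All derivatives in \<open>Ck_on\<close> are taken at \<open>x\<close> in the full space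
  and not within \<open>S\<close>, so they do not change when \<open>S\<close> is replaced by a
  neighbourhood of \<open>x\<close>. This matters for projections, whose smoothness is proved only
  near each point.\<close>

lemma Ck_on_locally:
  assumes "\<And>x. x \<in> S \<Longrightarrow> \<exists>T. open T \<and> x \<in> T \<and> Ck_on k T f"
  shows "Ck_on k S f"
  using assms
proof (induction k arbitrary: f)
  case 0
  show ?case unfolding Ck_on.simps
  proof (rule continuous_at_imp_continuous_on, rule ballI)
    fix x assume "x \<in> S"
    then obtain T where "open T" "x \<in> T" "continuous_on T f" using 0 by force
    then show "isCont f x" by (simp add: continuous_on_eq_continuous_at)
  qed
next
  case (Suc k)
  have "f differentiable (at x within S)" if x: "x \<in> S" for x
  proof -
    obtain T where "open T" "x \<in> T" "f differentiable_on T" using Suc.prems[OF x] by force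
    then show ?thesis
      by (meson differentiable_at_withinI differentiable_on_eq_differentiable_at)
  qed
  moreover have "Ck_on k S (\<lambda>x. frechet_derivative f (at x) v)" for v
    by (rule Suc.IH) (use Suc.prems in force)
  ultimately show ?case by (simp add: differentiable_on_def)
qed

lemma Ck_on_Suc_imp: "Ck_on (Suc k) S f \<Longrightarrow> Ck_on k S f"
  by (induction k arbitrary: f) (auto simp: differentiable_imp_continuous_on)

text \<open>Lets a derivative be supplied by an explicit formula: on \<open>S\<close> it agrees with
  \<open>frechet_derivative\<close>, and \<open>Ck_on_cong\<close> carries its regularity
  over.\<close>

lemma Ck_on_SucI:
  assumes "open S" "\<And>x. x \<in> S \<Longrightarrow> (f has_derivative f' x) (at x)"
    and "\<And>v. Ck_on k S (\<lambda>x. f' x v)"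
  shows "Ck_on (Suc k) S f"
proof -
  have "frechet_derivative f (at x) = f' x" if "x \<in> S" for x
    using frechet_derivative_at[OF assms(2)[OF that]] by simp
  then have "Ck_on k S (\<lambda>x. frechet_derivative f (at x) v)" for v
    using Ck_on_cong[OF assms(1) assms(3)[of v]] by simp
  then show ?thesis
    using assms(1,2) differentiableI by (fastforce simp: differentiable_on_eq_differentiable_at)
qed

lemma Ck_on_SucD:
  assumes "open S" "Ck_on (Suc k) S f"
  shows "x \<in> S \<Longrightarrow> (f has_derivative frechet_derivative f (at x)) (at x)"
    and "Ck_on k S (\<lambda>x. frechet_derivative f (at x) v)"
  using assms by (auto simp: differentiable_on_eq_differentiable_at frechet_derivative_works)

lemma Ck_on_const: "open S \<Longrightarrow> Ck_on k S (\<lambda>x. a)"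
proof (induction k arbitrary: a)
  case 0 then show ?case by simp
next
  case (Suc k)
  show ?case
    by (rule Ck_on_SucI[OF Suc.prems, where f' = "\<lambda>x v. 0"]) (use Suc in auto)
qed

lemma Ck_on_add:
  assumes "open S" shows "Ck_on k S f \<Longrightarrow> Ck_on k S g \<Longrightarrow> Ck_on k S (\<lambda>x. f x + g x)"
proof (induction k arbitrary: f g)
  case 0 then show ?case by (simp add: continuous_on_add)
next
  case (Suc k)
  note df = Ck_on_SucD[OF assms Suc.prems(1)] and dg = Ck_on_SucD[OF assms Suc.prems(2)]
  show ?case
    by (rule Ck_on_SucI[OF assms has_derivative_add[OF df(1) dg(1)]])
       (use Suc.IH[OF df(2) dg(2)] in auto)
qed

text \<open>One product rule serves scalar multiples, products and inner products. The derivative is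
  a sum of two values of \<open>h\<close>, each with one differentiated and one undifferentiated
  argument, so the induction runs over all pairs of functions.\<close>

lemma Ck_on_bilinear:
  assumes "open S" "bounded_bilinear h"
  shows "Ck_on k S f \<Longrightarrow> Ck_on k S g \<Longrightarrow> Ck_on k S (\<lambda>x. h (f x) (g x))"
proof (induction k arbitrary: f g)
  case 0 then show ?case by (simp add: bounded_bilinear.continuous_on[OF assms(2)])
next
  case (Suc k)
  note df = Ck_on_SucD[OF assms(1) Suc.prems(1)] and dg = Ck_on_SucD[OF assms(1) Suc.prems(2)]
  note lower = Suc.prems[THEN Ck_on_Suc_imp]
  show ?case
    by (rule Ck_on_SucI[OF assms(1) bounded_bilinear.FDERIV[OF assms(2) df(1) dg(1)]])
       (use Ck_on_add[OF assms(1) Suc.IH[OF lower(1) dg(2)] Suc.IH[OF df(2) lower(2)]] in auto)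
qed

text \<open>The derivative of 1/f is -(1/f) f' (1/f), which contains 1/f itself, but only one order
  of differentiability lower.\<close>

lemma Ck_on_inverse:
  fixes f :: "'a::euclidean_space \<Rightarrow> real"
  assumes "open S" "\<And>x. x \<in> S \<Longrightarrow> f x \<noteq> 0"
  shows "Ck_on k S f \<Longrightarrow> Ck_on k S (\<lambda>x. inverse (f x))"
proof (induction k)
  case 0 then show ?case using assms(2) by (simp add: continuous_on_inverse)
next
  case (Suc k)
  note df = Ck_on_SucD[OF assms(1) Suc.prems]
  note mult = Ck_on_bilinear[OF assms(1) bounded_bilinear_mult]
  have inv: "Ck_on k S (\<lambda>x. inverse (f x))" using Suc.IH Ck_on_Suc_imp[OF Suc.prems] .
  have "Ck_on k S (\<lambda>x. (- 1) * (inverse (f x) * frechet_derivative f (at x) v * inverse (f x)))" for v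
    by (intro mult Ck_on_const assms(1) inv df(2))
  then show ?case
    by (intro Ck_on_SucI[OF assms(1) Deriv.has_derivative_inverse[OF assms(2) df(1)]]) auto
qed

section \<open>Closure properties of smooth functions\<close>

lemma smooth_on_imp_continuous_on: "smooth_on S f \<Longrightarrow> continuous_on S f"
  unfolding smooth_on_def using Ck_on.simps(1) by blast

lemma smooth_on_imp_differentiable:
  assumes "open S" "smooth_on S f" "x \<in> S" shows "f differentiable (at x)"
  using assms unfolding smooth_on_def
  by (metis Ck_on.simps(2) differentiable_on_eq_differentiable_at)

lemma smooth_on_frechet:
  "smooth_on S f \<Longrightarrow> smooth_on S (\<lambda>x. frechet_derivative f (at x) v)"
  unfolding smooth_on_def using Ck_on.simps(2) by blast

lemma smooth_on_cong:
  "open S \<Longrightarrow> smooth_on S f \<Longrightarrow> (\<And>x. x \<in> S \<Longrightarrow> f x = g x) \<Longrightarrow> smooth_on S g"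
  unfolding smooth_on_def using Ck_on_cong by blast

lemma smooth_on_subset: "smooth_on S f \<Longrightarrow> T \<subseteq> S \<Longrightarrow> smooth_on T f"
  unfolding smooth_on_def using Ck_on_subset by blast

lemma smooth_on_locally:
  "(\<And>x. x \<in> S \<Longrightarrow> \<exists>T. open T \<and> x \<in> T \<and> smooth_on T f) \<Longrightarrow> smooth_on S f"
  unfolding smooth_on_def using Ck_on_locally by metis

lemma smooth_on_const: "open S \<Longrightarrow> smooth_on S (\<lambda>x. a)"
  unfolding smooth_on_def using Ck_on_const by blast

lemma smooth_on_add:
  "open S \<Longrightarrow> smooth_on S f \<Longrightarrow> smooth_on S g \<Longrightarrow> smooth_on S (\<lambda>x. f x + g x)"
  unfolding smooth_on_def using Ck_on_add by blast

lemma smooth_on_bilinear: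
  "open S \<Longrightarrow> bounded_bilinear h \<Longrightarrow> smooth_on S f \<Longrightarrow> smooth_on S g \<Longrightarrow>
    smooth_on S (\<lambda>x. h (f x) (g x))"
  unfolding smooth_on_def using Ck_on_bilinear by blast

lemmas smooth_on_scaleR = smooth_on_bilinear[OF _ bounded_bilinear_scaleR]
  and smooth_on_mult = smooth_on_bilinear[OF _ bounded_bilinear_mult]

lemma smooth_on_inner_const: "open S \<Longrightarrow> smooth_on S f \<Longrightarrow> smooth_on S (\<lambda>x. f x \<bullet> b)"
  by (rule smooth_on_bilinear[OF _ bounded_bilinear_inner]) (auto intro: smooth_on_const)

lemma smooth_on_diff:
  fixes f g :: "'a::euclidean_space \<Rightarrow> 'b::real_normed_vector"
  assumes "open S" "smooth_on S f" "smooth_on S g" shows "smooth_on S (\<lambda>x. f x - g x)"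
  using smooth_on_add[OF assms(1,2) smooth_on_scaleR[OF assms(1) smooth_on_const[OF assms(1), of "- 1"] assms(3)]]
  by simp

lemma smooth_on_sum:
  assumes "open S"
  shows "(\<And>i. i \<in> I \<Longrightarrow> smooth_on S (f i)) \<Longrightarrow> smooth_on S (\<lambda>x. \<Sum>i\<in>I. f i x)"
  using assms by (induction I rule: infinite_finite_induct) (auto intro: smooth_on_const smooth_on_add)

lemma smooth_on_inverse:
  fixes f :: "'a::euclidean_space \<Rightarrow> real"
  shows "open S \<Longrightarrow> (\<And>x. x \<in> S \<Longrightarrow> f x \<noteq> 0) \<Longrightarrow> smooth_on S f \<Longrightarrow> smooth_on S (\<lambda>x. inverse (f x))"
  unfolding smooth_on_def using Ck_on_inverse by blast

section \<open>Derivatives on a manifold\<close>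

text \<open>\<open>pdiff\<close> is the value of a choice operator and carries information only
  where a derivative exists. This predicate records existence as well, so that the calculus rules
  can be chained.\<close>

definition has_pdiff ::
  "('m, 'e::euclidean_space) chart set \<Rightarrow> ('m \<Rightarrow> 'b::real_normed_vector) \<Rightarrow> 'm \<Rightarrow> ('e \<Rightarrow> 'b) \<Rightarrow> bool" where
  "has_pdiff A h p h' \<longleftrightarrow>
     ((h \<circ> cinv (chart_at A p)) has_derivative h') (at (snd (chart_at A p) p))"

lemma has_pdiff_imp_pdiff: "has_pdiff A h p h' \<Longrightarrow> pdiff A h p = h'"
  unfolding has_pdiff_def pdiff_def[abs_def] by (simp add: frechet_derivative_at[symmetric])

lemma has_pdiff_linear: "has_pdiff A h p h' \<Longrightarrow> linear h'"
  unfolding has_pdiff_def by (rule has_derivative_linear)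

lemma has_pdiff_const: "has_pdiff A (\<lambda>q. a) p (\<lambda>v. 0)"
  unfolding has_pdiff_def by (simp add: o_def)

lemma has_pdiff_sum:
  "(\<And>i. i \<in> I \<Longrightarrow> has_pdiff A (h i) p (h' i)) \<Longrightarrow>
    has_pdiff A (\<lambda>q. \<Sum>i\<in>I. h i q) p (\<lambda>v. \<Sum>i\<in>I. h' i v)"
  unfolding has_pdiff_def o_def by (rule has_derivative_sum)

lemma has_pdiff_inner:
  assumes "has_pdiff A h p h'" shows "has_pdiff A (\<lambda>q. h q \<bullet> b) p (\<lambda>v. h' v \<bullet> b)"
  using assms unfolding has_pdiff_def o_def by (rule has_derivative_inner_left)

section \<open>Charts, change of chart and components of tangent vectors\<close>

locale smooth_manifold =
  fixes A :: "('m::{t2_space, second_countable_topology}, 'e::euclidean_space) chart set"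
  assumes smooth_atlas: "smooth_atlas A"
begin

lemma is_chart: "c \<in> A \<Longrightarrow> is_chart c"
  using smooth_atlas by (auto simp: smooth_atlas_def)

lemma open_chart_domain: "c \<in> A \<Longrightarrow> open (fst c)"
  and open_chart_range: "c \<in> A \<Longrightarrow> open (snd c ` fst c)"
  using is_chart by (auto simp: is_chart_def)

lemma cinv_chart: "c \<in> A \<Longrightarrow> p \<in> fst c \<Longrightarrow> cinv c (snd c p) = p"
  using is_chart by (auto simp: is_chart_def homeomorphism_def)

lemma chart_cinv: "c \<in> A \<Longrightarrow> x \<in> snd c ` fst c \<Longrightarrow> snd c (cinv c x) = x"
  and cinv_in_domain: "c \<in> A \<Longrightarrow> x \<in> snd c ` fst c \<Longrightarrow> cinv c x \<in> fst c"
  using cinv_chart[of c] by (auto simp del: split_paired_All)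

lemma open_chart_image:
  assumes "c \<in> A" "open W" shows "open (snd c ` (fst c \<inter> W))"
proof -
  have "openin (top_of_set (snd c ` fst c)) (snd c ` (fst c \<inter> W))"
    using homeomorphism_imp_open_map[of "fst c" "snd c ` fst c" "snd c" "cinv c" "fst c \<inter> W"]
      is_chart[OF assms(1)] assms(2) by (auto simp: is_chart_def openin_open)
  then show ?thesis using openin_open_trans open_chart_range[OF assms(1)] by blast
qed

lemma chart_at: "chart_at A p \<in> A" "p \<in> fst (chart_at A p)"
proof -
  have "p \<in> (\<Union>c\<in>A. fst c)" using smooth_atlas by (simp add: smooth_atlas_def)
  then have "\<exists>c. c \<in> A \<and> p \<in> fst c" by blast
  from someI_ex[OF this] show "chart_at A p \<in> A" "p \<in> fst (chart_at A p)"
    unfolding chart_at_def by auto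
qed

lemma transition_derivative:
  assumes "c \<in> A" "d \<in> A" "p \<in> fst c" "p \<in> fst d"
  shows "((snd d \<circ> cinv c) has_derivative frechet_derivative (snd d \<circ> cinv c) (at (snd c p)))
    (at (snd c p))"
proof -
  have "smooth_on (snd c ` (fst c \<inter> fst d)) (snd d \<circ> cinv c)"
    using smooth_atlas assms by (auto simp: smooth_atlas_def)
  from smooth_on_imp_differentiable[OF open_chart_image this] show ?thesis
    using assms open_chart_domain by (simp add: frechet_derivative_works)
qed

text \<open>Chain rule with the transition map from \<open>d\<close> to \<open>c\<close>. The
  composite equals \<open>h \<circ> cinv d\<close> only on the image of the overlap of the two
  domains, which is open.\<close>

lemma has_derivative_change_chart:
  assumes "c \<in> A" "d \<in> A" "p \<in> fst c" "p \<in> fst d"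
    and "((h \<circ> cinv c) has_derivative h') (at (snd c p))"
  shows "((h \<circ> cinv d) has_derivative (h' \<circ> frechet_derivative (snd c \<circ> cinv d) (at (snd d p))))
    (at (snd d p))"
proof -
  have "((h \<circ> cinv c) \<circ> (snd c \<circ> cinv d) has_derivative
      (h' \<circ> frechet_derivative (snd c \<circ> cinv d) (at (snd d p)))) (at (snd d p))"
    by (rule diff_chain_at[OF transition_derivative]) (use assms cinv_chart in auto)
  then show ?thesis
    by (rule has_derivative_transform_within_open[where s = "snd d ` (fst d \<inter> fst c)"])
       (use assms cinv_chart[of d] cinv_chart[of c] open_chart_image[of d] open_chart_domain[of c]
        in auto)
qed

text \<open>Frees computations from the arbitrary choice \<open>chart_at\<close>: the derivative of
  the transition map out of the chosen chart is exactly \<open>coord\<close>.\<close>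

lemma has_pdiff_chart:
  assumes "c \<in> A" "p \<in> fst c" "((h \<circ> cinv c) has_derivative h') (at (snd c p))"
  shows "has_pdiff A h p (\<lambda>v. h' (coord A c p v))"
  using has_derivative_change_chart[OF assms(1) chart_at(1) assms(2) chart_at(2) assms(3)]
  unfolding has_pdiff_def coord_def pdiff_def o_def .

lemma has_pdiff_transform:
  assumes "has_pdiff A h p h'" "open W" "p \<in> W" "\<And>q. q \<in> W \<Longrightarrow> h q = k q"
  shows "has_pdiff A k p h'"
  using assms(1) unfolding has_pdiff_def
  by (rule has_derivative_transform_within_open
        [where s = "snd (chart_at A p) ` (fst (chart_at A p) \<inter> W)"])
     (use assms chart_at[of p] cinv_chart[OF chart_at(1)] open_chart_image[OF chart_at(1)] in auto)

lemma has_pdiff_mult: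
  fixes h k :: "'m \<Rightarrow> real"
  assumes "has_pdiff A h p h'" "has_pdiff A k p k'"
  shows "has_pdiff A (\<lambda>q. h q * k q) p (\<lambda>v. h p * k' v + h' v * k p)"
  using has_derivative_mult[OF assms[unfolded has_pdiff_def]] cinv_chart[OF chart_at]
  unfolding has_pdiff_def o_def by simp

lemma has_pdiff_coord:
  assumes "c \<in> A" "p \<in> fst c" shows "has_pdiff A (snd c) p (coord A c p)"
  unfolding has_pdiff_def
  by (rule has_derivative_eq_rhs[OF transition_derivative])
     (use assms chart_at in \<open>auto simp: coord_def[abs_def] pdiff_def\<close>)

lemma linear_coord: "c \<in> A \<Longrightarrow> p \<in> fst c \<Longrightarrow> linear (coord A c p)"
  by (rule has_pdiff_linear[OF has_pdiff_coord])

lemma linear_cvec: "c \<in> A \<Longrightarrow> p \<in> fst c \<Longrightarrow> linear (cvec A c p)"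
  unfolding cvec_def[abs_def]
  by (rule has_derivative_linear[OF transition_derivative[OF _ chart_at(1) _ chart_at(2)]])

text \<open>Computed by changing from \<open>c\<close> to \<open>d\<close>, the derivative of
  \<open>snd d \<circ> cinv d\<close> is the composite of the two transition derivatives; computed
  directly it is the identity.\<close>

lemma transition_inverse:
  assumes "c \<in> A" "d \<in> A" "p \<in> fst c" "p \<in> fst d"
  shows "frechet_derivative (snd d \<circ> cinv c) (at (snd c p))
    (frechet_derivative (snd c \<circ> cinv d) (at (snd d p)) v) = v"
proof -
  have "((snd d \<circ> cinv d) has_derivative
    (frechet_derivative (snd d \<circ> cinv c) (at (snd c p)) \<circ>
      frechet_derivative (snd c \<circ> cinv d) (at (snd d p)))) (at (snd d p))"
    by (rule has_derivative_change_chart) (use assms transition_derivative in auto)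
  moreover have "((snd d \<circ> cinv d) has_derivative (\<lambda>v. v)) (at (snd d p))"
    by (rule has_derivative_transform_within_open[where s = "snd d ` fst d", OF has_derivative_ident])
       (use assms chart_cinv open_chart_range in auto)
  ultimately show ?thesis
    using has_derivative_unique[of _ _ "snd d p"] by (metis comp_apply)
qed

lemma coord_cvec: "c \<in> A \<Longrightarrow> p \<in> fst c \<Longrightarrow> coord A c p (cvec A c p u) = u"
  and cvec_coord: "c \<in> A \<Longrightarrow> p \<in> fst c \<Longrightarrow> cvec A c p (coord A c p v) = v"
  using transition_inverse[OF _ chart_at(1) _ chart_at(2)] transition_inverse[OF chart_at(1) _ chart_at(2)]
  unfolding coord_def cvec_def pdiff_def by blast+

section \<open>Smooth functions, fields and endomorphisms\<close>

lemma smooth_fun_has_pdiff: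
  assumes "smooth_fun_on A W f" "open W" "p \<in> W"
  shows "has_pdiff A f p (pdiff A f p)"
proof -
  let ?c = "chart_at A p"
  have "smooth_on (snd ?c ` (fst ?c \<inter> W)) (f \<circ> cinv ?c)"
    using assms(1) chart_at by (auto simp: smooth_fun_on_def)
  from smooth_on_imp_differentiable[OF open_chart_image this, of "snd ?c p"] show ?thesis
    using assms chart_at
    unfolding has_pdiff_def pdiff_def[abs_def] frechet_derivative_works by auto
qed

text \<open>In a chart, X f is the sum of the components of X times the partial derivatives of
  f.\<close>

lemma smooth_fun_pdiff_field:
  assumes f: "smooth_fun_on A W f" "open W" and X: "smooth_field A X"
  shows "smooth_fun_on A W (\<lambda>q. pdiff A f q (X q))"
  unfolding smooth_fun_on_def
proof
  fix c assume c: "c \<in> A"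
  let ?O = "snd c ` (fst c \<inter> W)"
  define E where "E x = coord A c (cinv c x) (X (cinv c x))" for x
  note O = open_chart_image[OF c f(2)]
  have fc: "smooth_on ?O (f \<circ> cinv c)" using f(1) c by (auto simp: smooth_fun_on_def)
  have E: "smooth_on ?O E"
    using X c unfolding smooth_field_def E_def by (blast intro: smooth_on_subset)
  have "smooth_on ?O (\<lambda>x. \<Sum>b\<in>Basis. (E x \<bullet> b) * frechet_derivative (f \<circ> cinv c) (at x) b)"
    by (intro smooth_on_sum smooth_on_mult smooth_on_inner_const smooth_on_frechet O E fc)
  then show "smooth_on ?O ((\<lambda>q. pdiff A f q (X q)) \<circ> cinv c)"
  proof (rule smooth_on_cong[OF O])
    fix x assume x: "x \<in> ?O"
    then have q: "cinv c x \<in> fst c" "snd c (cinv c x) = x"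
      using cinv_in_domain[OF c] chart_cinv[OF c] by blast+
    have d: "((f \<circ> cinv c) has_derivative frechet_derivative (f \<circ> cinv c) (at x)) (at x)"
      using smooth_on_imp_differentiable[OF O fc x] frechet_derivative_works by blast
    have "pdiff A f (cinv c x) (X (cinv c x)) = frechet_derivative (f \<circ> cinv c) (at x) (E x)"
      using has_pdiff_imp_pdiff[OF has_pdiff_chart[OF c q(1), unfolded q(2), OF d]] by (simp add: E_def)
    also have "\<dots> = frechet_derivative (f \<circ> cinv c) (at x) (\<Sum>b\<in>Basis. (E x \<bullet> b) *\<^sub>R b)"
      by (simp add: euclidean_representation)
    also have "\<dots> = (\<Sum>b\<in>Basis. (E x \<bullet> b) * frechet_derivative (f \<circ> cinv c) (at x) b)"
      using has_derivative_linear[OF d] by (simp add: linear_sum linear_scale)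
    finally show "(\<Sum>b\<in>Basis. (E x \<bullet> b) * frechet_derivative (f \<circ> cinv c) (at x) b) =
        ((\<lambda>q. pdiff A f q (X q)) \<circ> cinv c) x" by simp
  qed
qed

lemma smooth_field_diff:
  assumes "smooth_field A X" "smooth_field A Y"
  shows "smooth_field A (\<lambda>q. X q - Y q)"
  unfolding smooth_field_def
proof
  fix c assume c: "c \<in> A"
  have "smooth_on (snd c ` fst c)
    (\<lambda>x. coord A c (cinv c x) (X (cinv c x)) - coord A c (cinv c x) (Y (cinv c x)))"
    by (intro smooth_on_diff open_chart_range c) (use assms c in \<open>auto simp: smooth_field_def\<close>)
  then show "smooth_on (snd c ` fst c)
    (\<lambda>x. coord A c (cinv c x) (X (cinv c x) - Y (cinv c x)))"
    by (rule smooth_on_cong[OF open_chart_range[OF c]])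
       (simp add: linear_diff[OF linear_coord[OF c cinv_in_domain[OF c]]])
qed

text \<open>\<open>smooth_endo\<close> tests \<open>J\<close> only on fields with constant
  components, so X is expanded in the coordinate frame.\<close>

lemma smooth_field_endo:
  assumes "smooth_endo A J" "smooth_field A X"
  shows "smooth_field A (\<lambda>q. J q (X q))"
  unfolding smooth_field_def
proof
  fix c assume c: "c \<in> A"
  let ?O = "snd c ` fst c"
  note O = open_chart_range[OF c]
  define E where "E x = coord A c (cinv c x) (X (cinv c x))" for x
  have "smooth_on ?O (\<lambda>x. \<Sum>b\<in>Basis. (E x \<bullet> b) *\<^sub>R
      coord A c (cinv c x) (J (cinv c x) (cvec A c (cinv c x) b)))"
    by (intro smooth_on_sum smooth_on_scaleR smooth_on_inner_const O)
       (use assms c in \<open>auto simp: smooth_field_def smooth_endo_def E_def\<close>)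
  then show "smooth_on ?O (\<lambda>x. coord A c (cinv c x) (J (cinv c x) (X (cinv c x))))"
  proof (rule smooth_on_cong[OF O])
    fix x assume "x \<in> ?O"
    then have q: "cinv c x \<in> fst c" using c cinv_in_domain by blast
    let ?L = "\<lambda>u. coord A c (cinv c x) (J (cinv c x) (cvec A c (cinv c x) u))"
    have L: "linear ?L"
      using linear_compose[OF linear_compose[OF linear_cvec[OF c q]] linear_coord[OF c q]] assms(1)
      unfolding smooth_endo_def o_def by blast
    have "?L (E x) = ?L (\<Sum>b\<in>Basis. (E x \<bullet> b) *\<^sub>R b)" by (simp add: euclidean_representation)
    also have "\<dots> = (\<Sum>b\<in>Basis. (E x \<bullet> b) *\<^sub>R ?L b)"
      by (simp only: linear_sum[OF L] linear_scale[OF L])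
    finally show "(\<Sum>b\<in>Basis. (E x \<bullet> b) *\<^sub>R ?L b) =
        coord A c (cinv c x) (J (cinv c x) (X (cinv c x)))"
      using cvec_coord[OF c q] by (simp add: E_def)
  qed
qed

text \<open>Chain rule for functions pulled back along \<pi>. Inserting the chart \<open>d\<close>
  is harmless only over its domain, whose preimage is open by continuity.\<close>

lemma has_pdiff_composition:
  assumes d: "smooth_manifold B" "d \<in> B" "\<pi> p \<in> fst d"
    and \<pi>: "continuous_on UNIV \<pi>" "has_pdiff A (snd d \<circ> \<pi>) p h'"
    and k: "((k \<circ> cinv d) has_derivative k') (at (snd d (\<pi> p)))"
  shows "has_pdiff A (\<lambda>q. k (\<pi> q)) p (\<lambda>v. k' (h' v))"
proof -
  interpret B: smooth_manifold B by fact
  have "((k \<circ> cinv d) \<circ> (snd d \<circ> \<pi> \<circ> cinv (chart_at A p)) has_derivative (k' \<circ> h'))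
    (at (snd (chart_at A p) p))"
    by (rule diff_chain_at) (use \<pi>(2) k cinv_chart[OF chart_at] in \<open>auto simp: has_pdiff_def\<close>)
  then have "has_pdiff A ((k \<circ> cinv d) \<circ> (snd d \<circ> \<pi>)) p (k' \<circ> h')"
    by (simp add: has_pdiff_def o_assoc)
  then have "has_pdiff A (\<lambda>q. k (\<pi> q)) p (k' \<circ> h')"
  proof (rule has_pdiff_transform)
    show "open (\<pi> -` fst d)" using \<pi>(1) B.open_chart_domain d(2) open_vimage by blast
  qed (use d B.cinv_chart in auto)
  then show ?thesis by (simp add: o_def)
qed

end

section \<open>Smoothness of orthogonal projections\<close>

definition inner_form :: "('e::euclidean_space \<Rightarrow> 'e \<Rightarrow> real) \<Rightarrow> bool" where
  "inner_form b \<longleftrightarrow> bilinear b \<and> (\<forall>v w. b v w = b w v) \<and> (\<forall>v. v \<noteq> 0 \<longrightarrow> b v v > 0)"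

lemma inner_formD:
  assumes "inner_form b"
  shows "bilinear b" "b v w = b w v" "v \<noteq> 0 \<Longrightarrow> b v v > 0" "b v v = 0 \<longleftrightarrow> v = 0"
proof -
  show *: "bilinear b" and "b v w = b w v" and pos: "v \<noteq> 0 \<Longrightarrow> b v v > 0"
    using assms unfolding inner_form_def by blast+
  show "b v v = 0 \<longleftrightarrow> v = 0" using pos bilinear_lzero[OF *, of 0] by force
qed

lemmas inner_form_simps = bilinear_ladd[OF inner_formD(1)] bilinear_radd[OF inner_formD(1)]
  bilinear_lsub[OF inner_formD(1)] bilinear_rsub[OF inner_formD(1)]
  bilinear_lmul[OF inner_formD(1)] bilinear_rmul[OF inner_formD(1)]
  bilinear_lneg[OF inner_formD(1)] bilinear_rneg[OF inner_formD(1)]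
  bilinear_lzero[OF inner_formD(1)] bilinear_rzero[OF inner_formD(1)]

lemma inner_form_linear:
  assumes "inner_form b" shows "linear (b v)" "linear (\<lambda>v. b v w)"
  using inner_formD(1)[OF assms] by (simp_all add: bilinear_def)

lemma orthogonal_to_span:
  assumes "inner_form b" "\<And>s. s \<in> S \<Longrightarrow> b v s = 0" "u \<in> span S" shows "b v u = 0"
  by (rule linear_eq_on_span[OF inner_form_linear(1)[OF assms(1)] module_hom_zero assms(2) assms(3)])

text \<open>Gram-Schmidt with parameters. Only the vector \<open>W x\<close> added last has to stay nonzero, so the
  neighbourhood \<open>S\<close> does not depend on \<open>E\<close>.\<close>

lemma local_orthogonal_projection:
  fixes G :: "'a::euclidean_space \<Rightarrow> 'e::euclidean_space \<Rightarrow> 'e \<Rightarrow> real"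
  assumes O: "open R" "x0 \<in> R"
    and G: "\<And>x. x \<in> R \<Longrightarrow> inner_form (G x)"
      "\<And>S E F. open S \<Longrightarrow> S \<subseteq> R \<Longrightarrow> smooth_on S E \<Longrightarrow> smooth_on S F \<Longrightarrow>
         smooth_on S (\<lambda>x. G x (E x) (F x))"
    and B: "finite B" "\<And>b. b \<in> B \<Longrightarrow> smooth_on R (V b)"
      "inj_on (\<lambda>b. V b x0) B" "independent ((\<lambda>b. V b x0) ` B)"
  shows "\<exists>S. open S \<and> x0 \<in> S \<and> S \<subseteq> R \<and>
    (\<forall>x\<in>S. inj_on (\<lambda>b. V b x) B \<and> independent ((\<lambda>b. V b x) ` B)) \<and>
    (\<forall>E. smooth_on R E \<longrightarrow> (\<exists>F. smooth_on S F \<and>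
      (\<forall>x\<in>S. F x \<in> span ((\<lambda>b. V b x) ` B) \<and> (\<forall>b\<in>B. G x (E x - F x) (V b x) = 0))))"
  using B
proof (induction B rule: finite_induct)
  case empty
  then show ?case using O smooth_on_const[OF O(1), of 0] by (intro exI[of _ R]) auto
next
  case (insert a B)
  have im: "(\<lambda>b. V b x) ` insert a B = insert (V a x) ((\<lambda>b. V b x) ` B)" for x by simp
  have indep: "independent ((\<lambda>b. V b x0) ` B)" "V a x0 \<notin> span ((\<lambda>b. V b x0) ` B)"
    using insert.prems(2,3) insert.hyps(2) unfolding im
    by (auto simp: independent_insert split: if_splits)
  obtain S where S: "open S" "x0 \<in> S" "S \<subseteq> R"
      "\<And>x. x \<in> S \<Longrightarrow> inj_on (\<lambda>b. V b x) B \<and> independent ((\<lambda>b. V b x) ` B)"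
    and proj: "\<And>E. smooth_on R E \<Longrightarrow> \<exists>F. smooth_on S F \<and>
      (\<forall>x\<in>S. F x \<in> span ((\<lambda>b. V b x) ` B) \<and> (\<forall>b\<in>B. G x (E x - F x) (V b x) = 0))"
    using insert.IH[OF _ inj_on_subset[OF insert.prems(2) subset_insertI] indep(1)] insert.prems(1)
    by (blast intro: insertI2)
  obtain F0 where F0: "smooth_on S F0" "\<And>x. x \<in> S \<Longrightarrow> F0 x \<in> span ((\<lambda>b. V b x) ` B)"
      "\<And>x b. x \<in> S \<Longrightarrow> b \<in> B \<Longrightarrow> G x (V a x - F0 x) (V b x) = 0"
    using proj[of "V a"] insert.prems(1) by blast
  \<comment> \<open>The part of the new frame vector orthogonal to the earlier ones.\<close>
  define W where "W x = V a x - F0 x" for x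
  have Va: "smooth_on S (V a)" using insert.prems(1) S(3) smooth_on_subset by blast
  have W: "smooth_on S W" unfolding W_def by (intro smooth_on_diff S Va F0)
  \<comment> \<open>\<open>W x0\<close> is nonzero because \<open>V a x0\<close> is outside the span
    of the earlier vectors; by continuity this persists near \<open>x0\<close>.\<close>
  define T where "T = S \<inter> W -` (- {0})"
  have T: "open T" "T \<subseteq> S" "\<And>x. x \<in> T \<Longrightarrow> W x \<noteq> 0" "x0 \<in> T"
    unfolding T_def
    using continuous_open_preimage[OF smooth_on_imp_continuous_on[OF W] S(1), of "- {0}"]
      indep(2) F0(2)[OF S(2)] S(2) by (auto simp: W_def)
  have Wspan: "G x (W x) u = 0" if "x \<in> S" "u \<in> span ((\<lambda>b. V b x) ` B)" for x u
    unfolding W_def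
    by (rule orthogonal_to_span[OF G(1) _ that(2)]) (use that(1) F0(3) S(3) in auto)
  have notin: "V a x \<notin> span ((\<lambda>b. V b x) ` B)" if "x \<in> T" for x
  proof
    assume "V a x \<in> span ((\<lambda>b. V b x) ` B)"
    then have "W x \<in> span ((\<lambda>b. V b x) ` B)" using F0(2) that T(2) by (auto simp: W_def span_diff)
    then have "G x (W x) (W x) = 0" using Wspan that T(2) by blast
    then show False using T(3)[OF that] inner_formD(4)[OF G(1)] that T(2) S(3) by blast
  qed
  have inj: "inj_on (\<lambda>b. V b x) (insert a B) \<and> independent ((\<lambda>b. V b x) ` insert a B)"
    if "x \<in> T" for x
  proof -
    have "V a x \<notin> (\<lambda>b. V b x) ` B" by (rule contrapos_nn[OF notin[OF that] span_base])
    then show ?thesis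
      using notin[OF that] S(4)[of x] that T(2) unfolding im
      by (auto simp: independent_insert)
  qed
  have projT: "\<exists>F. smooth_on T F \<and> (\<forall>x\<in>T. F x \<in> span ((\<lambda>b. V b x) ` insert a B) \<and>
      (\<forall>b\<in>insert a B. G x (E x - F x) (V b x) = 0))" if E: "smooth_on R E" for E
  proof -
    obtain F1 where F1: "smooth_on S F1" "\<And>x. x \<in> S \<Longrightarrow> F1 x \<in> span ((\<lambda>b. V b x) ` B)"
        "\<And>x b. x \<in> S \<Longrightarrow> b \<in> B \<Longrightarrow> G x (E x - F1 x) (V b x) = 0"
      using proj[OF E] by blast
    \<comment> \<open>The coefficient for which \<open>E x - F x\<close> becomes orthogonal to
      \<open>W x\<close>; the earlier orthogonality relations survive since \<open>W x\<close> is
      orthogonal to the earlier vectors.\<close>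
    define r where "r x = G x (E x - F1 x) (W x) * inverse (G x (W x) (W x))" for x
    define F where "F x = F1 x + r x *\<^sub>R W x" for x
    have ne: "G x (W x) (W x) \<noteq> 0" if "x \<in> T" for x
      using inner_formD(4)[OF G(1)] T(2,3) that S(3) by blast
    have TO: "T \<subseteq> R" using T(2) S(3) by blast
    note sub = smooth_on_subset[OF F1(1) T(2)] smooth_on_subset[OF W T(2)] smooth_on_subset[OF E TO]
    have "smooth_on T F"
      unfolding F_def r_def
      by (intro smooth_on_add smooth_on_scaleR smooth_on_mult smooth_on_inverse smooth_on_diff
          G(2) T(1) TO sub ne)
    moreover have "F x \<in> span ((\<lambda>b. V b x) ` insert a B)" if "x \<in> T" for x
    proof -
      have "u \<in> span ((\<lambda>b. V b x) ` insert a B)" if "u \<in> span ((\<lambda>b. V b x) ` B)" for u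
        using span_mono[OF image_mono[OF subset_insertI]] that by (rule subsetD)
      then show ?thesis
        using F1(2) F0(2) that T(2) unfolding F_def W_def
        by (intro span_add span_scale span_diff) (auto intro: span_base)
    qed
    moreover have "G x (E x - F x) (V b x) = 0" if x: "x \<in> T" and b: "b \<in> insert a B" for x b
    proof -
      have xS: "x \<in> S" "x \<in> R" using x T(2) S(3) by auto
      note G' = G(1)[OF xS(2)]
      have split: "G x (E x - F x) u = G x (E x - F1 x) u - r x * G x (W x) u" for u
        by (simp add: F_def inner_form_simps[OF G'] algebra_simps)
      have old: "G x (E x - F x) (V b x) = 0" if "b \<in> B" for b
        using F1(3)[OF xS(1) that] Wspan[OF xS(1) span_base[OF imageI[OF that]]] by (simp add: split)
      have "G x (E x - F x) (W x) = 0" using ne[OF x] by (simp add: split r_def)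
      \<comment> \<open>\<open>V a x\<close> is \<open>W x + F0 x\<close>, and \<open>F0 x\<close>
        lies in the span of the earlier vectors.\<close>
      moreover have "G x (E x - F x) (F0 x) = 0"
        by (rule orthogonal_to_span[OF G' _ F0(2)[OF xS(1)]]) (use old in auto)
      ultimately have "G x (E x - F x) (V a x) = 0"
        by (simp add: W_def inner_form_simps[OF G'])
      then show ?thesis using b old by auto
    qed
    ultimately show ?thesis by (intro exI[of _ F] conjI ballI)
  qed
  show ?case
  proof (intro exI[of _ T] conjI)
    show "\<forall>x\<in>T. inj_on (\<lambda>b. V b x) (insert a B) \<and> independent ((\<lambda>b. V b x) ` insert a B)"
      using inj by blast
    show "\<forall>E. smooth_on R E \<longrightarrow> (\<exists>F. smooth_on T F \<and>
        (\<forall>x\<in>T. F x \<in> span ((\<lambda>b. V b x) ` insert a B) \<and>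
          (\<forall>b\<in>insert a B. G x (E x - F x) (V b x) = 0)))"
      by (intro allI impI projT)
  qed (use T S(3) in auto)
qed

section \<open>Orthogonal projections, pointwise and in families\<close>

lemma orth_proj_unique:
  assumes "inner_form b" "subspace S" "w \<in> S" "\<And>u. u \<in> S \<Longrightarrow> b (v - w) u = 0"
  shows "orth_proj b S v = w"
  unfolding orth_proj_def
proof (rule the_equality)
  fix w' assume w': "w' \<in> S \<and> (\<forall>u\<in>S. b (v - w') u = 0)"
  \<comment> \<open>The difference of two candidates lies in \<open>S\<close> and is therefore
    orthogonal to itself.\<close>
  then have "w' - w \<in> S" using assms(2,3) subspace_diff by blast
  then have "b (w' - w) (w' - w) = b (v - w) (w' - w) - b (v - w') (w' - w)"
    by (simp add: inner_form_simps[OF assms(1)])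
  also have "\<dots> = 0" using w' assms(4) \<open>w' - w \<in> S\<close> by simp
  finally show "w' = w" using inner_formD(4)[OF assms(1)] by simp
qed (use assms in auto)

text \<open>Existence at a single point is the parametric Gram-Schmidt process for a constant form
  and a constant frame, evaluated at the parameter 0.\<close>

lemma orth_proj_exists:
  fixes S :: "'e::euclidean_space set"
  assumes b: "inner_form b" and S: "subspace S"
  shows "\<exists>w\<in>S. \<forall>u\<in>S. b (v - w) u = 0"
proof -
  obtain B where B: "B \<subseteq> S" "independent B" "S \<subseteq> span B" "finite B"
    using basis_exists[of S] finiteI_independent by metis
  have smooth: "smooth_on T (\<lambda>x. b (E x) (F x))"
    if "open T" "T \<subseteq> UNIV" "smooth_on T E" "smooth_on T F" for T :: "'e set" and E F
    using smooth_on_bilinear[OF that(1) _ that(3,4)] bilinear_conv_bounded_bilinear inner_formD(1)[OF b]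
    by blast
  obtain S0 where S0: "(0::'e) \<in> S0" "\<And>E. smooth_on UNIV E \<Longrightarrow> \<exists>F. smooth_on S0 F \<and>
      (\<forall>x\<in>S0. F x \<in> span ((\<lambda>u. u) ` B) \<and> (\<forall>u\<in>B. b (E x - F x) u = 0))"
    using local_orthogonal_projection[of UNIV 0 "\<lambda>x. b" B "\<lambda>u x. u",
      OF open_UNIV UNIV_I b smooth B(4) smooth_on_const[OF open_UNIV]] B(2)
    by (elim meta_impE) (simp_all, metis)
  have "\<exists>w\<in>span B. \<forall>u\<in>B. b (v - w) u = 0"
    using S0(2)[OF smooth_on_const[OF open_UNIV, of v]] S0(1) by auto
  then show ?thesis
    using orthogonal_to_span[OF b, of B] B(3) span_minimal[OF B(1) S] by blast
qed

lemma orth_proj: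
  assumes "inner_form b" "subspace S"
  shows "orth_proj b S v \<in> S" "u \<in> S \<Longrightarrow> b (v - orth_proj b S v) u = 0"
proof -
  obtain w where w: "w \<in> S" "\<And>u. u \<in> S \<Longrightarrow> b (v - w) u = 0"
    using orth_proj_exists[OF assms] by blast
  then show "orth_proj b S v \<in> S" "u \<in> S \<Longrightarrow> b (v - orth_proj b S v) u = 0"
    using orth_proj_unique[OF assms w] by simp_all
qed

text \<open>A basis of \<open>D x0\<close> is extended to sections, which stay independent near
  \<open>x0\<close>. As the dimension is constant they still span \<open>D x\<close> there, so the
  smooth map from Gram-Schmidt is the projection.\<close>

lemma smooth_on_orth_proj:
  fixes G :: "'e::euclidean_space \<Rightarrow> 'e \<Rightarrow> 'e \<Rightarrow> real"
  assumes O: "open R"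
    and G: "\<And>x. x \<in> R \<Longrightarrow> inner_form (G x)"
      "\<And>S E F. open S \<Longrightarrow> S \<subseteq> R \<Longrightarrow> smooth_on S E \<Longrightarrow> smooth_on S F \<Longrightarrow>
         smooth_on S (\<lambda>x. G x (E x) (F x))"
    and D: "\<And>x. x \<in> R \<Longrightarrow> subspace (D x)" "\<And>x. x \<in> R \<Longrightarrow> dim (D x) = k"
      "\<And>x v. x \<in> R \<Longrightarrow> v \<in> D x \<Longrightarrow> \<exists>V. smooth_on R V \<and> (\<forall>y\<in>R. V y \<in> D y) \<and> V x = v"
    and E: "smooth_on R E"
  shows "smooth_on R (\<lambda>x. orth_proj (G x) (D x) (E x))"
proof (rule smooth_on_locally)
  fix x0 assume x0: "x0 \<in> R"
  obtain B where B: "B \<subseteq> D x0" "independent B" "card B = k"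
    using basis_exists[of "D x0"] D(2)[OF x0] by metis
  obtain V where V: "\<And>b. b \<in> B \<Longrightarrow> smooth_on R (V b)"
      "\<And>b y. b \<in> B \<Longrightarrow> y \<in> R \<Longrightarrow> V b y \<in> D y" "\<And>b. b \<in> B \<Longrightarrow> V b x0 = b"
    using D(3)[OF x0 subsetD[OF B(1)]] by metis
  have im: "(\<lambda>b. V b x0) ` B = B" "inj_on (\<lambda>b. V b x0) B"
    using V(3) by (auto simp: inj_on_def)
  have "\<exists>S. open S \<and> x0 \<in> S \<and> S \<subseteq> R \<and>
    (\<forall>x\<in>S. inj_on (\<lambda>b. V b x) B \<and> independent ((\<lambda>b. V b x) ` B)) \<and>
    (\<forall>E. smooth_on R E \<longrightarrow> (\<exists>F. smooth_on S F \<and>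
      (\<forall>x\<in>S. F x \<in> span ((\<lambda>b. V b x) ` B) \<and> (\<forall>b\<in>B. G x (E x - F x) (V b x) = 0))))"
    by (rule local_orthogonal_projection[OF O x0 G finiteI_independent[OF B(2)] V(1) im(2)])
       (simp_all add: im(1) B(2))
  then obtain S where S: "open S" "x0 \<in> S" "S \<subseteq> R"
    and inj: "\<forall>x\<in>S. inj_on (\<lambda>b. V b x) B \<and> independent ((\<lambda>b. V b x) ` B)"
    and "\<exists>F. smooth_on S F \<and> (\<forall>x\<in>S. F x \<in> span ((\<lambda>b. V b x) ` B) \<and>
      (\<forall>b\<in>B. G x (E x - F x) (V b x) = 0))"
    using E by (elim exE conjE) (rule that, assumption+, drule spec, drule mp, assumption+)
  then obtain F where F: "smooth_on S F"
    "\<forall>x\<in>S. F x \<in> span ((\<lambda>b. V b x) ` B) \<and> (\<forall>b\<in>B. G x (E x - F x) (V b x) = 0)"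
    by (elim exE conjE) (rule that)
  have span: "span ((\<lambda>b. V b x) ` B) = D x" if "x \<in> S" for x
  proof (rule subspace_dim_equal)
    show "span ((\<lambda>b. V b x) ` B) \<subseteq> D x"
      using V(2) that S(3) D(1) by (intro span_minimal) auto
    show "dim (D x) \<le> dim (span ((\<lambda>b. V b x) ` B))"
      using dim_eq_card_independent[OF conjunct2[OF bspec[OF inj that]]] card_image[OF conjunct1[OF bspec[OF inj that]]]
        that S(3) D(2) B(3) by auto
  qed (use D(1) S(3) that in auto)
  have "F x = orth_proj (G x) (D x) (E x)" if x: "x \<in> S" for x
  proof -
    have O: "x \<in> R" using x S(3) by blast
    have "G x (E x - F x) u = 0" if "u \<in> D x" for u
      by (rule orthogonal_to_span[OF G(1)[OF O], of "(\<lambda>b. V b x) ` B"])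
         (use that span[OF x] F(2) x in auto)
    then show ?thesis
      using orth_proj_unique[OF G(1)[OF O] D(1)[OF O]] F(2) x span[OF x] by metis
  qed
  then have "smooth_on S (\<lambda>x. orth_proj (G x) (D x) (E x))"
    by (rule smooth_on_cong[OF S(1) F(1)])
  then show "\<exists>T. open T \<and> x0 \<in> T \<and> smooth_on T (\<lambda>x. orth_proj (G x) (D x) (E x))"
    using S by blast
qed

text \<open>Expanding both arguments in the standard basis reduces the claim to the matrix entries
  \<open>G x b c\<close>.\<close>

lemma smooth_on_bilinear_family:
  fixes G :: "'a::euclidean_space \<Rightarrow> 'e::euclidean_space \<Rightarrow> 'e \<Rightarrow> real"
  assumes "open S" "\<And>x. x \<in> S \<Longrightarrow> bilinear (G x)" "\<And>u v. smooth_on S (\<lambda>x. G x u v)"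
    and "smooth_on S E" "smooth_on S F"
  shows "smooth_on S (\<lambda>x. G x (E x) (F x))"
proof -
  have "smooth_on S (\<lambda>x. \<Sum>b\<in>Basis. \<Sum>c\<in>Basis. (E x \<bullet> b) * ((F x \<bullet> c) * G x b c))"
    by (intro smooth_on_sum smooth_on_mult smooth_on_inner_const assms)
  then show ?thesis
  proof (rule smooth_on_cong[OF assms(1)])
    fix x assume "x \<in> S"
    note b = assms(2)[OF this]
    have lin: "linear (G x u)" "linear (\<lambda>u. G x u v)" for u v using b by (auto simp: bilinear_def)
    have F: "G x u (F x) = (\<Sum>c\<in>Basis. (F x \<bullet> c) * G x u c)" for u
      using linear_sum[OF lin(1)[of u], of "\<lambda>c. (F x \<bullet> c) *\<^sub>R c" Basis]
      by (simp add: euclidean_representation bilinear_rmul[OF b])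
    have "G x (E x) (F x) = (\<Sum>b\<in>Basis. (E x \<bullet> b) * G x b (F x))"
      using linear_sum[OF lin(2)[of "F x"], of "\<lambda>b. (E x \<bullet> b) *\<^sub>R b" Basis]
      by (simp add: euclidean_representation bilinear_lmul[OF b])
    also have "\<dots> = (\<Sum>b\<in>Basis. (E x \<bullet> b) * (\<Sum>c\<in>Basis. (F x \<bullet> c) * G x b c))"
      by (simp only: F)
    finally show "(\<Sum>b\<in>Basis. \<Sum>c\<in>Basis. (E x \<bullet> b) * ((F x \<bullet> c) * G x b c)) = G x (E x) (F x)"
      by (simp add: sum_distrib_left)
  qed
qed

section \<open>The metric in a chart and projections of smooth fields\<close>

locale riemannian =
  fixes M :: "('m::{t2_space, second_countable_topology}, 'e::euclidean_space) riem"
  assumes riemannian_manifold: "riemannian_manifold M"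
begin

sublocale smooth_manifold "atlas M"
  using riemannian_manifold by unfold_locales (simp add: riemannian_manifold_def)

lemma metric: "inner_form (rmetric M p)"
  using riemannian_manifold by (simp add: riemannian_manifold_def inner_form_def)

text \<open>Reads the metric as a family of forms on one fixed vector space, parametrized by an open
  set, as the Gram-Schmidt lemmas require.\<close>

definition metric_in :: "('m, 'e) chart \<Rightarrow> 'e \<Rightarrow> 'e \<Rightarrow> 'e \<Rightarrow> real" where
  "metric_in c x u v =
     rmetric M (cinv c x) (cvec (atlas M) c (cinv c x) u) (cvec (atlas M) c (cinv c x) v)"

lemma metric_in_inner_form:
  assumes c: "c \<in> atlas M" "x \<in> snd c ` fst c" shows "inner_form (metric_in c x)"
proof -
  let ?L = "cvec (atlas M) c (cinv c x)"
  have q: "cinv c x \<in> fst c" using c cinv_in_domain by blast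
  note L = linear_cvec[OF c(1) q] and g = metric[of "cinv c x"]
  have "?L u \<noteq> 0" if "u \<noteq> 0" for u
    using coord_cvec[OF c(1) q, of u] linear_0[OF linear_coord[OF c(1) q]] that by auto
  moreover have "bilinear (metric_in c x)"
    unfolding bilinear_def metric_in_def
    using linear_compose[OF L inner_form_linear(1)[OF g]] linear_compose[OF L inner_form_linear(2)[OF g]]
    by (simp add: o_def)
  ultimately show ?thesis
    using inner_formD(2,3)[OF g] unfolding inner_form_def by (simp add: metric_in_def)
qed

lemma smooth_on_metric_in:
  assumes c: "c \<in> atlas M" and S: "open S" "S \<subseteq> snd c ` fst c" and E: "smooth_on S E" "smooth_on S F"
  shows "smooth_on S (\<lambda>x. metric_in c x (E x) (F x))"
proof (rule smooth_on_bilinear_family[OF S(1) _ _ E])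
  show "bilinear (metric_in c x)" if "x \<in> S" for x
    using metric_in_inner_form[OF c] S(2) that inner_formD(1) by blast
  show "smooth_on S (\<lambda>x. metric_in c x u v)" for u v
  proof (rule smooth_on_subset[OF _ S(2)])
    show "smooth_on (snd c ` fst c) (\<lambda>x. metric_in c x u v)"
      using riemannian_manifold c by (simp add: riemannian_manifold_def metric_in_def)
  qed
qed

lemma metric_in_coord:
  assumes "c \<in> atlas M" "p \<in> fst c"
  shows "metric_in c (snd c p) (coord (atlas M) c p v) (coord (atlas M) c p w) = rmetric M p v w"
  using assms by (simp add: metric_in_def cinv_chart cvec_coord)

text \<open>Taking components in a chart is an isometry onto \<open>metric_in\<close> and maps
  \<open>D\<close> onto a family of subspaces of the same dimension. By uniqueness it commutes with
  the projection, so \<open>smooth_on_orth_proj\<close> applies in each chart.\<close>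

lemma smooth_field_orth_proj:
  assumes D: "distribution M D" and X: "smooth_field (atlas M) X"
  shows "smooth_field (atlas M) (\<lambda>p. orth_proj (rmetric M p) (D p) (X p))"
  unfolding smooth_field_def
proof
  fix c assume c: "c \<in> atlas M"
  let ?O = "snd c ` fst c"
  define \<kappa> where "\<kappa> x = coord (atlas M) c (cinv c x)" for x
  define D' where "D' x = \<kappa> x ` D (cinv c x)" for x
  obtain k where k: "\<And>p. dim (D p) = k" using D by (auto simp: distribution_def)
  have sub: "subspace (D p)" for p using D by (simp add: distribution_def)
  have \<kappa>: "linear (\<kappa> x)" "inj (\<kappa> x)" if "x \<in> ?O" for x
    using linear_coord[OF c cinv_in_domain[OF c that]] cvec_coord[OF c cinv_in_domain[OF c that]]
    unfolding \<kappa>_def by (auto intro: inj_on_inverseI)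
  have metric_\<kappa>: "metric_in c x (\<kappa> x v) (\<kappa> x w) = rmetric M (cinv c x) v w" if "x \<in> ?O" for x v w
    using metric_in_coord[OF c cinv_in_domain[OF c that]] chart_cinv[OF c that] by (simp add: \<kappa>_def)
  have field: "smooth_on ?O (\<lambda>x. \<kappa> x (E (cinv c x)))" if "smooth_field (atlas M) E" for E
    using that c by (simp add: smooth_field_def \<kappa>_def)
  have "smooth_on ?O (\<lambda>x. orth_proj (metric_in c x) (D' x) (\<kappa> x (X (cinv c x))))"
  proof (rule smooth_on_orth_proj[OF open_chart_range[OF c] metric_in_inner_form[OF c]
        smooth_on_metric_in[OF c] _ _ _ field[OF X]])
    fix x assume x: "x \<in> ?O"
    show "subspace (D' x)"
      unfolding D'_def by (rule linear_subspace_image[OF \<kappa>(1)[OF x] sub])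
    show "dim (D' x) = k"
      unfolding D'_def k[of "cinv c x", symmetric]
      by (rule dim_image_eq[OF \<kappa>(1)[OF x] inj_on_subset[OF \<kappa>(2)[OF x] subset_UNIV]])
    fix v assume "v \<in> D' x"
    then obtain w where w: "w \<in> D (cinv c x)" "v = \<kappa> x w" by (auto simp: D'_def)
    then obtain V where V: "section_of M D V" "V (cinv c x) = w"
      using D unfolding distribution_def by blast
    show "\<exists>V. smooth_on ?O V \<and> (\<forall>y\<in>?O. V y \<in> D' y) \<and> V x = v"
    proof (intro exI conjI)
      show "smooth_on ?O (\<lambda>x. \<kappa> x (V (cinv c x)))"
        by (rule field) (use V(1) in \<open>simp add: section_of_def\<close>)
    qed (use V w in \<open>auto simp: section_of_def D'_def\<close>)
  qed
  then show "smooth_on ?O (\<lambda>x. coord (atlas M) c (cinv c x)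
    (orth_proj (rmetric M (cinv c x)) (D (cinv c x)) (X (cinv c x))))"
  proof (rule smooth_on_cong[OF open_chart_range[OF c]])
    fix x assume x: "x \<in> ?O"
    note proj = orth_proj[OF metric sub]
    have "orth_proj (metric_in c x) (D' x) (\<kappa> x (X (cinv c x))) =
      \<kappa> x (orth_proj (rmetric M (cinv c x)) (D (cinv c x)) (X (cinv c x)))"
    proof (rule orth_proj_unique[OF metric_in_inner_form[OF c x]])
      show "subspace (D' x)"
        unfolding D'_def by (rule linear_subspace_image[OF \<kappa>(1)[OF x] sub])
      fix u assume "u \<in> D' x"
      then obtain w where w: "w \<in> D (cinv c x)" "u = \<kappa> x w" by (auto simp: D'_def)
      show "metric_in c x (\<kappa> x (X (cinv c x)) -
        \<kappa> x (orth_proj (rmetric M (cinv c x)) (D (cinv c x)) (X (cinv c x)))) u = 0"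
        unfolding w(2) linear_diff[OF \<kappa>(1)[OF x], symmetric] metric_\<kappa>[OF x] by (rule proj(2)[OF w(1)])
    qed (use proj(1) in \<open>auto simp: D'_def\<close>)
    then show "orth_proj (metric_in c x) (D' x) (\<kappa> x (X (cinv c x))) = coord (atlas M) c (cinv c x)
      (orth_proj (rmetric M (cinv c x)) (D (cinv c x)) (X (cinv c x)))"
      by (simp add: \<kappa>_def)
  qed
qed

end

section \<open>Rules for the Levi-Civita connection\<close>

locale riemannian_connection = riemannian M
  for M :: "('m::{t2_space, second_countable_topology}, 'e::euclidean_space) riem" +
  fixes nabla :: "('m \<Rightarrow> 'e) \<Rightarrow> ('m \<Rightarrow> 'e) \<Rightarrow> ('m \<Rightarrow> 'e)"
  assumes levi_civita: "levi_civita M nabla"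
begin

lemma nabla_add:
  assumes "smooth_field (atlas M) X" "smooth_field (atlas M) Y" "smooth_field (atlas M) Z"
  shows "nabla Z (\<lambda>q. X q + Y q) p = nabla Z X p + nabla Z Y p"
  using levi_civita assms by (simp add: levi_civita_def)

lemma metric_compatible:
  assumes "smooth_field (atlas M) X" "smooth_field (atlas M) Y" "smooth_field (atlas M) Z"
  shows "pdiff (atlas M) (\<lambda>q. rmetric M q (Y q) (Z q)) p (X p) =
    rmetric M p (nabla X Y p) (Z p) + rmetric M p (Y p) (nabla X Z p)"
  using levi_civita assms by (simp add: levi_civita_def)

text \<open>Metric compatibility, where the differentiated function is constantly zero.\<close>

lemma nabla_skew:
  assumes "smooth_field (atlas M) X" "smooth_field (atlas M) Y" "smooth_field (atlas M) Z"
    and "\<And>q. rmetric M q (Y q) (Z q) = 0"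
  shows "rmetric M p (nabla X Y p) (Z p) = - rmetric M p (Y p) (nabla X Z p)"
  using metric_compatible[OF assms(1-3), of p]
  by (simp add: assms(4) has_pdiff_imp_pdiff[OF has_pdiff_const])

lemma torsion_free:
  assumes "smooth_field (atlas M) X" "smooth_field (atlas M) Y"
    and "open W" "smooth_fun_on (atlas M) W f" "p \<in> W"
  shows "pdiff (atlas M) f p (nabla X Y p - nabla Y X p) =
    pdiff (atlas M) (\<lambda>q. pdiff (atlas M) f q (Y q)) p (X p) -
    pdiff (atlas M) (\<lambda>q. pdiff (atlas M) f q (X q)) p (Y p)"
  using levi_civita assms by (simp add: levi_civita_def)

end

section \<open>Riemannian submersions\<close>

locale submersion = M: riemannian M + N: riemannian N
  for M :: "('m::{t2_space, second_countable_topology}, 'e::euclidean_space) riem"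
    and N :: "('n::{t2_space, second_countable_topology}, 'f::euclidean_space) riem" +
  fixes \<pi> :: "'m \<Rightarrow> 'n"
  assumes submersion: "riemannian_submersion M N \<pi>"
begin

abbreviation "dpi \<equiv> push (atlas M) (atlas N) \<pi>"

section \<open>The differential of \<pi> in charts\<close>

lemma continuous_pi: "continuous_on UNIV \<pi>"
  using submersion by (simp add: riemannian_submersion_def smooth_mapping_def)

lemma open_vimage_chart: "d \<in> atlas N \<Longrightarrow> open (\<pi> -` fst d)"
  using continuous_pi N.open_chart_domain by (simp add: continuous_on_open_vimage)

text \<open>These chart components of \<pi> are the local test functions to which
  \<open>torsion_free\<close> is applied.\<close>

lemma smooth_fun_pi:
  assumes "d \<in> atlas N"
  shows "smooth_fun_on (atlas M) (\<pi> -` fst d) (\<lambda>q. snd d (\<pi> q) \<bullet> b)"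
  unfolding smooth_fun_on_def
proof
  fix c assume c: "c \<in> atlas M"
  then have "smooth_on (snd c ` (fst c \<inter> \<pi> -` fst d)) (snd d \<circ> \<pi> \<circ> cinv c)"
    using submersion assms by (simp add: riemannian_submersion_def smooth_mapping_def)
  from smooth_on_inner_const[OF M.open_chart_image[OF c open_vimage_chart[OF assms]] this, of b]
  show "smooth_on (snd c ` (fst c \<inter> \<pi> -` fst d)) ((\<lambda>q. snd d (\<pi> q) \<bullet> b) \<circ> cinv c)"
    by (simp add: o_def)
qed

lemma has_pdiff_push: "has_pdiff (atlas M) (snd (chart_at (atlas N) (\<pi> p)) \<circ> \<pi>) p (dpi p)"
proof -
  let ?c = "chart_at (atlas M) p" and ?d = "chart_at (atlas N) (\<pi> p)"
  have "smooth_on (snd ?c ` (fst ?c \<inter> \<pi> -` fst ?d)) (snd ?d \<circ> \<pi> \<circ> cinv ?c)"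
    using submersion M.chart_at N.chart_at by (simp add: riemannian_submersion_def smooth_mapping_def)
  then have "(snd ?d \<circ> \<pi> \<circ> cinv ?c) differentiable (at (snd ?c p))"
    by (rule smooth_on_imp_differentiable[OF M.open_chart_image[OF M.chart_at(1)
          open_vimage_chart[OF N.chart_at(1)]]]) (use M.chart_at N.chart_at in auto)
  then show ?thesis
    by (simp add: has_pdiff_def frechet_derivative_works push_def[abs_def] pdiff_def)
qed

lemma has_pdiff_chart_pi:
  assumes d: "d \<in> atlas N" "\<pi> p \<in> fst d"
  shows "has_pdiff (atlas M) (snd d \<circ> \<pi>) p (\<lambda>v. coord (atlas N) d (\<pi> p) (dpi p v))"
  using M.has_pdiff_composition[OF N.smooth_manifold_axioms N.chart_at continuous_pi has_pdiff_push
      N.has_pdiff_coord[OF d, unfolded has_pdiff_def]]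
  by (simp add: o_def)

lemma pdiff_chart_pi:
  assumes "d \<in> atlas N" "\<pi> p \<in> fst d"
  shows "pdiff (atlas M) (\<lambda>q. snd d (\<pi> q) \<bullet> b) p v = coord (atlas N) d (\<pi> p) (dpi p v) \<bullet> b"
  using has_pdiff_imp_pdiff[OF has_pdiff_inner[OF has_pdiff_chart_pi[OF assms]]] by (simp add: o_def)

text \<open>The differential of a function pulled back from N factors through that of \<pi>, which
  kills vertical vectors.\<close>

lemma has_pdiff_lift:
  assumes d: "d \<in> atlas N" "\<pi> p \<in> fst d" and k: "smooth_on (snd d ` fst d) (k \<circ> cinv d)"
    and v: "v \<in> vertical M N \<pi> p"
  obtains h' where "has_pdiff (atlas M) (\<lambda>q. k (\<pi> q)) p h'" "h' v = 0"
proof -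
  have x: "snd d (\<pi> p) \<in> snd d ` fst d" using d(2) by blast
  have "(k \<circ> cinv d) differentiable (at (snd d (\<pi> p)))"
    by (rule smooth_on_imp_differentiable[OF N.open_chart_range[OF d(1)] k x])
  then have k': "((k \<circ> cinv d) has_derivative frechet_derivative (k \<circ> cinv d) (at (snd d (\<pi> p))))
    (at (snd d (\<pi> p)))"
    by (simp add: frechet_derivative_works)
  show thesis
  proof (rule that)
    show "has_pdiff (atlas M) (\<lambda>q. k (\<pi> q)) p (\<lambda>v. frechet_derivative (k \<circ> cinv d)
      (at (snd d (\<pi> p))) (coord (atlas N) d (\<pi> p) (dpi p v)))"
      by (rule M.has_pdiff_composition[OF N.smooth_manifold_axioms d continuous_pi has_pdiff_chart_pi[OF d] k'])
    show "frechet_derivative (k \<circ> cinv d) (at (snd d (\<pi> p))) (coord (atlas N) d (\<pi> p) (dpi p v)) = 0"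
      using v linear_0[OF has_derivative_linear[OF k']] linear_0[OF N.linear_coord[OF d]]
      by (simp add: vertical_def)
  qed
qed

section \<open>Vertical and horizontal parts\<close>

lemma linear_push: "linear (dpi p)"
  by (rule has_pdiff_linear[OF has_pdiff_push])

lemma subspace_vertical: "subspace (vertical M N \<pi> p)"
  unfolding vertical_def by (rule linear_subspace_kernel[OF linear_push])

lemma subspace_horizontal: "subspace (horizontal M N \<pi> p)"
  unfolding horizontal_def subspace_def by (simp add: inner_form_simps[OF M.metric])

lemma ver_vertical: "ver M N \<pi> E p \<in> vertical M N \<pi> p"
  unfolding ver_def by (rule orth_proj(1)[OF M.metric subspace_vertical])

lemma metric_ver: "v \<in> vertical M N \<pi> p \<Longrightarrow> rmetric M p (ver M N \<pi> E p) v = rmetric M p (E p) v"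
proof -
  assume "v \<in> vertical M N \<pi> p"
  from orth_proj(2)[OF M.metric subspace_vertical this] show ?thesis
    by (simp add: ver_def inner_form_simps[OF M.metric])
qed

text \<open>What remains of \<open>E p\<close> after removing the vertical projection is orthogonal
  to the kernel, and the removed part is orthogonal to all horizontal vectors.\<close>

lemma hor_eq: "hor M N \<pi> E p = E p - ver M N \<pi> E p"
  unfolding hor_def
proof (rule orth_proj_unique[OF M.metric subspace_horizontal])
  show "E p - ver M N \<pi> E p \<in> horizontal M N \<pi> p"
    using orth_proj(2)[OF M.metric subspace_vertical] by (simp add: horizontal_def ver_def)
  show "rmetric M p (E p - (E p - ver M N \<pi> E p)) u = 0" if "u \<in> horizontal M N \<pi> p" for u
    using that ver_vertical[of E p] inner_formD(2)[OF M.metric, of p "ver M N \<pi> E p" u]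
    by (simp add: horizontal_def)
qed

lemma hor_horizontal: "hor M N \<pi> E p \<in> horizontal M N \<pi> p"
  unfolding hor_def by (rule orth_proj(1)[OF M.metric subspace_horizontal])

lemma metric_hor: "v \<in> vertical M N \<pi> p \<Longrightarrow> rmetric M p (hor M N \<pi> E p) v = 0"
  using hor_horizontal by (simp add: horizontal_def)

lemma ver_vertical_field: "(\<And>p. E p \<in> vertical M N \<pi> p) \<Longrightarrow> ver M N \<pi> E = E"
  unfolding ver_def
  by (rule ext, rule orth_proj_unique[OF M.metric subspace_vertical])
     (simp_all add: inner_form_simps[OF M.metric])

lemma hor_horizontal_field: "(\<And>p. E p \<in> horizontal M N \<pi> p) \<Longrightarrow> hor M N \<pi> E = E"
  unfolding hor_def
  by (rule ext, rule orth_proj_unique[OF M.metric subspace_horizontal])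
     (simp_all add: inner_form_simps[OF M.metric])

lemma horizontal_vertical: "h \<in> horizontal M N \<pi> p \<Longrightarrow> v \<in> vertical M N \<pi> p \<Longrightarrow> rmetric M p h v = 0"
  by (simp add: horizontal_def)

text \<open>Pairing with a vertical vector kills the horizontal summand and absorbs the outer
  vertical projection.\<close>

lemma metric_oneill_T:
  assumes "v \<in> vertical M N \<pi> p"
  shows "rmetric M p (oneill_T M N \<pi> nabla E G p) v =
    rmetric M p (nabla (ver M N \<pi> E) (hor M N \<pi> G) p) v"
  by (simp add: oneill_T_def inner_form_simps[OF M.metric] metric_ver[OF assms] metric_hor[OF assms])

lemma metric_oneill_A:
  assumes "v \<in> vertical M N \<pi> p"
  shows "rmetric M p (oneill_A M N \<pi> nabla E G p) v =
    rmetric M p (nabla (hor M N \<pi> E) (hor M N \<pi> G) p) v"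
  by (simp add: oneill_A_def inner_form_simps[OF M.metric] metric_ver[OF assms] metric_hor[OF assms])

end

section \<open>Brackets with vertical fields and derivatives of basic fields\<close>

locale submersion_connection = submersion M N \<pi> + riemannian_connection M nabla
  for M :: "('m::{t2_space, second_countable_topology}, 'e::euclidean_space) riem"
    and N :: "('n::{t2_space, second_countable_topology}, 'f::euclidean_space) riem"
    and \<pi> :: "'m \<Rightarrow> 'n" and nabla :: "('m \<Rightarrow> 'e) \<Rightarrow> ('m \<Rightarrow> 'e) \<Rightarrow> ('m \<Rightarrow> 'e)"
begin

text \<open>For a vertical field \<open>V\<close> the functions \<open>V (x\<^sub>b \<circ> \<pi>)\<close> vanish identically, so only one of the two
  second derivatives in \<open>[V, H] (x\<^sub>b \<circ> \<pi>)\<close> survives.\<close>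

lemma bracket_chart_pi:
  assumes V: "smooth_field (atlas M) V" "\<And>q. V q \<in> vertical M N \<pi> q"
    and H: "smooth_field (atlas M) H" and d: "d \<in> atlas N" "\<pi> p \<in> fst d"
  shows "pdiff (atlas M) (\<lambda>q. pdiff (atlas M) (\<lambda>q. snd d (\<pi> q) \<bullet> b) q (H q)) p (V p) =
    coord (atlas N) d (\<pi> p) (dpi p (nabla V H p - nabla H V p)) \<bullet> b"
proof -
  let ?W = "\<pi> -` fst d" and ?f = "\<lambda>q. snd d (\<pi> q) \<bullet> b"
  have W: "open ?W" "p \<in> ?W" using open_vimage_chart d by auto
  have "pdiff (atlas M) ?f q (V q) = 0" if "q \<in> ?W" for q
    using pdiff_chart_pi[OF d(1)] that V(2)[of q] linear_0[OF N.linear_coord[OF d(1)]]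
    by (simp add: vertical_def)
  then have "has_pdiff (atlas M) (\<lambda>q. pdiff (atlas M) ?f q (V q)) p (\<lambda>v. 0)"
    by (intro M.has_pdiff_transform[OF has_pdiff_const W]) simp
  then have "pdiff (atlas M) (\<lambda>q. pdiff (atlas M) ?f q (V q)) p (H p) = 0"
    by (simp add: has_pdiff_imp_pdiff)
  with torsion_free[OF V(1) H W(1) smooth_fun_pi[OF d(1)] W(2)] show ?thesis
    by (simp add: pdiff_chart_pi[OF d])
qed

text \<open>When both fields are vertical, the second derivative left over in
  \<open>bracket_chart_pi\<close> vanishes too, so every chart component of the projected bracket is
  zero.\<close>

lemma bracket_vertical:
  assumes V: "smooth_field (atlas M) V" "\<And>q. V q \<in> vertical M N \<pi> q"
    and U: "smooth_field (atlas M) U" "\<And>q. U q \<in> vertical M N \<pi> q"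
  shows "nabla V U p - nabla U V p \<in> vertical M N \<pi> p"
proof -
  let ?d = "chart_at (atlas N) (\<pi> p)"
  let ?w = "nabla V U p - nabla U V p"
  note d = N.chart_at[of "\<pi> p"]
  have *: "pdiff (atlas M) (\<lambda>q. snd ?d (\<pi> q) \<bullet> b) q (U q) = 0" if "q \<in> \<pi> -` fst ?d" for q b
    using pdiff_chart_pi[OF d(1)] that U(2)[of q] linear_0[OF N.linear_coord[OF d(1)]]
    by (simp add: vertical_def)
  have "has_pdiff (atlas M) (\<lambda>q. pdiff (atlas M) (\<lambda>q. snd ?d (\<pi> q) \<bullet> b) q (U q)) p (\<lambda>v. 0)" for b
    by (rule M.has_pdiff_transform[OF has_pdiff_const open_vimage_chart[OF d(1)]])
       (use * d(2) in auto)
  from has_pdiff_imp_pdiff[OF this]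
  have "coord (atlas N) ?d (\<pi> p) (dpi p ?w) \<bullet> b = 0" for b
    using bracket_chart_pi[OF V U(1) d, of b] by simp
  then have "coord (atlas N) ?d (\<pi> p) (dpi p ?w) = 0"
    using inner_eq_zero_iff by blast
  then have "dpi p ?w = 0"
    using N.cvec_coord[OF d, of "dpi p ?w"] linear_0[OF N.linear_cvec[OF d]] by simp
  then show ?thesis by (simp add: vertical_def)
qed

text \<open>Since K is \<pi>-related to Z near p, g(H,K) is a sum of products of components of the
  projection of H with functions pulled back from N. The latter have zero derivative along V, and
  differentiating the former produces the bracket [V,H].\<close>

lemma vertical_derivative_metric:
  assumes V: "smooth_field (atlas M) V" "\<And>q. V q \<in> vertical M N \<pi> q"
    and H: "smooth_field (atlas M) H" "\<And>q. H q \<in> horizontal M N \<pi> q"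
    and K: "basic_on M N \<pi> W K" "open W" "p \<in> W"
  shows "pdiff (atlas M) (\<lambda>q. rmetric M q (H q) (K q)) p (V p) =
    rmetric M p (nabla V H p - nabla H V p) (K p)"
proof -
  let ?d = "chart_at (atlas N) (\<pi> p)"
  let ?w = "nabla V H p - nabla H V p"
  note d = N.chart_at[of "\<pi> p"]
  obtain Z where Z: "smooth_field (atlas N) Z" "\<And>q. q \<in> W \<Longrightarrow> dpi q (K q) = Z (\<pi> q)"
    and Kh: "\<And>q. q \<in> W \<Longrightarrow> K q \<in> horizontal M N \<pi> q"
    using K(1) by (auto simp: basic_on_def)
  \<comment> \<open>\<open>f b\<close> is the component of the projected field H along
    \<open>b\<close> in the chart \<open>?d\<close>; \<open>a b\<close> in the next line is the
    component of the covector dual to Z.\<close>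
  define f where "f b q = pdiff (atlas M) (\<lambda>q. snd ?d (\<pi> q) \<bullet> b) q (H q)" for b q
  define a where "a b y = rmetric N y (cvec (atlas N) ?d y b) (Z y)" for b y
  have isometry: "rmetric N (\<pi> q) (dpi q v) (dpi q w) = rmetric M q v w"
    if "v \<in> horizontal M N \<pi> q" "w \<in> horizontal M N \<pi> q" for q v w
    using submersion that by (simp add: riemannian_submersion_def)
  have expand: "rmetric N y z (Z y) = (\<Sum>b\<in>Basis. (coord (atlas N) ?d y z \<bullet> b) * a b y)"
    if "y \<in> fst ?d" for y z
  proof -
    note lin = linear_compose[OF N.linear_cvec[OF d(1) that] inner_form_linear(2)[OF N.metric[of y], of "Z y"]]
    have "rmetric N y z (Z y) = (rmetric N y (cvec (atlas N) ?d y
        (\<Sum>b\<in>Basis. (coord (atlas N) ?d y z \<bullet> b) *\<^sub>R b)) (Z y))"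
      by (simp add: euclidean_representation N.cvec_coord[OF d(1) that])
    also have "\<dots> = (\<Sum>b\<in>Basis. (coord (atlas N) ?d y z \<bullet> b) * a b y)"
      using linear_sum[OF lin, of "\<lambda>b. (coord (atlas N) ?d y z \<bullet> b) *\<^sub>R b" Basis] linear_scale[OF lin]
      by (simp add: a_def)
    finally show ?thesis .
  qed
  have "smooth_on (snd ?d ` fst ?d) (a b \<circ> cinv ?d)" for b
  proof -
    have "smooth_on (snd ?d ` fst ?d)
      (\<lambda>x. N.metric_in ?d x b (coord (atlas N) ?d (cinv ?d x) (Z (cinv ?d x))))"
      using Z(1) d(1)
      by (intro N.smooth_on_metric_in[OF d(1)] smooth_on_const N.open_chart_range[OF d(1)])
         (auto simp: smooth_field_def)
    then show ?thesis
      by (rule smooth_on_cong[OF N.open_chart_range[OF d(1)]])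
         (simp add: N.metric_in_def a_def N.cvec_coord[OF d(1) N.cinv_in_domain[OF d(1)]])
  qed
  then have "\<exists>h'. has_pdiff (atlas M) (\<lambda>q. a b (\<pi> q)) p h' \<and> h' (V p) = 0" for b
    by (rule has_pdiff_lift[OF d _ V(2)]) blast
  then obtain a' where a': "\<And>b. has_pdiff (atlas M) (\<lambda>q. a b (\<pi> q)) p (a' b)" "\<And>b. a' b (V p) = 0"
    by metis
  have f': "has_pdiff (atlas M) (f b) p (pdiff (atlas M) (f b) p)" for b
    unfolding f_def[abs_def]
    by (rule M.smooth_fun_has_pdiff[OF M.smooth_fun_pdiff_field[OF smooth_fun_pi[OF d(1)]
          open_vimage_chart[OF d(1)] H(1)] open_vimage_chart[OF d(1)]]) (simp add: d(2))
  have "has_pdiff (atlas M) (\<lambda>q. \<Sum>b\<in>Basis. f b q * a b (\<pi> q)) p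
      (\<lambda>v. \<Sum>b\<in>Basis. f b p * a' b v + pdiff (atlas M) (f b) p v * a b (\<pi> p))"
    by (intro has_pdiff_sum M.has_pdiff_mult f' a'(1))
  then have "has_pdiff (atlas M) (\<lambda>q. rmetric M q (H q) (K q)) p
      (\<lambda>v. \<Sum>b\<in>Basis. f b p * a' b v + pdiff (atlas M) (f b) p v * a b (\<pi> p))"
  proof (rule M.has_pdiff_transform)
    show "open (W \<inter> \<pi> -` fst ?d)" by (intro open_Int K(2) open_vimage_chart d(1))
    fix q assume "q \<in> W \<inter> \<pi> -` fst ?d"
    then show "(\<Sum>b\<in>Basis. f b q * a b (\<pi> q)) = rmetric M q (H q) (K q)"
      using expand[of "\<pi> q" "dpi q (H q)"] isometry[OF H(2) Kh, of q] Z(2)[of q]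
      by (simp add: f_def pdiff_chart_pi[OF d(1)])
  qed (use K(3) d(2) in auto)
  then have "pdiff (atlas M) (\<lambda>q. rmetric M q (H q) (K q)) p (V p) =
      (\<Sum>b\<in>Basis. (coord (atlas N) ?d (\<pi> p) (dpi p ?w) \<bullet> b) * a b (\<pi> p))"
    using bracket_chart_pi[OF V H(1) d]
    by (simp add: has_pdiff_imp_pdiff a'(2) f_def[abs_def])
  also have "\<dots> = rmetric N (\<pi> p) (dpi p ?w) (dpi p (K p))"
    using expand[OF d(2)] Z(2)[OF K(3)] by simp
  \<comment> \<open>The isometry is available on horizontal vectors only; dropping the vertical part
    of \<open>?w\<close> does not change its image.\<close>
  also have "dpi p ?w = dpi p (hor M N \<pi> (\<lambda>q. ?w) p)"
    using ver_vertical[of "\<lambda>q. ?w" p] by (simp add: hor_eq linear_diff[OF linear_push] vertical_def)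
  also have "rmetric N (\<pi> p) (dpi p (hor M N \<pi> (\<lambda>q. ?w) p)) (dpi p (K p)) =
      rmetric M p (hor M N \<pi> (\<lambda>q. ?w) p) (K p)"
    by (rule isometry[OF hor_horizontal Kh[OF K(3)]])
  also have "\<dots> = rmetric M p ?w (K p)"
    using horizontal_vertical[OF Kh[OF K(3)] ver_vertical[of "\<lambda>q. ?w"]] inner_formD(2)[OF M.metric]
    by (simp add: hor_eq inner_form_simps[OF M.metric])
  finally show ?thesis .
qed

lemma nabla_horizontal_vertical_skew:
  assumes "smooth_field (atlas M) E" and H: "smooth_field (atlas M) H" "\<And>q. H q \<in> horizontal M N \<pi> q"
    and V: "smooth_field (atlas M) V" "\<And>q. V q \<in> vertical M N \<pi> q"
  shows "rmetric M p (nabla E H p) (V p) = - rmetric M p (H p) (nabla E V p)"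
  by (rule nabla_skew[OF assms(1) H(1) V(1) horizontal_vertical[OF H(2) V(2)]])

text \<open>Metric compatibility and \<open>vertical_derivative_metric\<close> give two expressions
  for V g(H,K); the term with the derivative of H along V cancels.\<close>

lemma nabla_horizontal_basic:
  assumes V: "smooth_field (atlas M) V" "\<And>q. V q \<in> vertical M N \<pi> q"
    and H: "smooth_field (atlas M) H" "\<And>q. H q \<in> horizontal M N \<pi> q"
    and K: "basic_on M N \<pi> W K" "open W" "p \<in> W"
  shows "rmetric M p (H p) (nabla V K p) = - rmetric M p (nabla H V p) (K p)"
proof -
  have "smooth_field (atlas M) K" using K(1) by (simp add: basic_on_def)
  from metric_compatible[OF V(1) H(1) this, of p] vertical_derivative_metric[OF assms]
  show ?thesis by (simp add: inner_form_simps[OF M.metric])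
qed

end

section \<open>Bi-slant submersions\<close>

text \<open>\<open>J_orth\<close> makes P map D1 into itself and D2 into the complement of D1, so
  slant computations for D1 stay inside D1.\<close>

locale bi_slant =
  fixes M :: "('m::{t2_space, second_countable_topology}, 'e::euclidean_space) riem"
    and N :: "('n::{t2_space, second_countable_topology}, 'f::euclidean_space) riem"
    and nabla :: "('m \<Rightarrow> 'e) \<Rightarrow> ('m \<Rightarrow> 'e) \<Rightarrow> ('m \<Rightarrow> 'e)"
    and J :: "'m \<Rightarrow> 'e \<Rightarrow> 'e"
    and \<pi> :: "'m \<Rightarrow> 'n"
    and D1 D2 :: "'m \<Rightarrow> 'e set"
    and \<theta>\<^sub>1 \<theta>\<^sub>2 :: real
  assumes bi_slant: "bi_slant_submersion M N nabla J \<pi> D1 D2 \<theta>\<^sub>1 \<theta>\<^sub>2"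
    and J_orth: "\<And>p x u. x \<in> D1 p \<Longrightarrow> u \<in> D2 p \<Longrightarrow> rmetric M p (J p x) u = 0"
begin

sublocale submersion_connection M N \<pi> nabla
  using bi_slant
  by unfold_locales (simp_all add: bi_slant_submersion_def kaehler_def riemannian_submersion_def)

section \<open>The complex structure and the two distributions\<close>

abbreviation "g \<equiv> rmetric M"
abbreviation "vert \<equiv> vertical M N \<pi>"
abbreviation "field \<equiv> smooth_field (atlas M)"

lemmas g_simps = inner_form_simps[OF M.metric]

lemma g_sym: "g p v w = g p w v"
  by (rule inner_formD(2)[OF M.metric])

lemma J_linear: "linear (J p)"
  and J_J: "J p (J p v) = - v"
  and J_isometry: "g p (J p v) (J p w) = g p v w"
  and J_smooth: "smooth_endo (atlas M) J"
  and nabla_J: "field X \<Longrightarrow> field Y \<Longrightarrow> nabla X (\<lambda>q. J q (Y q)) p = J p (nabla X Y p)"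
  using bi_slant by (simp_all add: bi_slant_submersion_def kaehler_def smooth_endo_def)

lemma J_skew: "g p (J p v) w = - g p v (J p w)"
  using J_isometry[of p v "J p w"] by (simp add: J_J g_simps)

lemma distribution: "distribution M D1" "distribution M D2"
  using bi_slant by (simp_all add: bi_slant_submersion_def slant_def)

lemma subspace: "subspace (D1 p)" "subspace (D2 p)"
  using distribution by (simp_all add: distribution_def)

lemma vertical_eq: "vert p = {x + u | x u. x \<in> D1 p \<and> u \<in> D2 p}"
  and D1_orth_D2: "x \<in> D1 p \<Longrightarrow> u \<in> D2 p \<Longrightarrow> g p x u = 0"
  using bi_slant by (simp_all add: bi_slant_submersion_def)

lemma D1_vertical: "x \<in> D1 p \<Longrightarrow> x \<in> vert p"
  and D2_vertical: "u \<in> D2 p \<Longrightarrow> u \<in> vert p"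
  unfolding vertical_eq using subspace_0[OF subspace(1)] subspace_0[OF subspace(2)]
  by (force intro: exI[of _ 0])+

text \<open>The D2 component of such a vector is orthogonal to itself.\<close>

lemma vertical_in_D1:
  assumes "v \<in> vert p" "\<And>u. u \<in> D2 p \<Longrightarrow> g p v u = 0"
  shows "v \<in> D1 p"
proof -
  obtain x u where xu: "x \<in> D1 p" "u \<in> D2 p" "v = x + u" using assms(1) by (auto simp: vertical_eq)
  then have "g p u u = 0" using assms(2)[OF xu(2)] D1_orth_D2[OF xu(1,2)] by (simp add: g_simps)
  then show ?thesis using xu inner_formD(4)[OF M.metric] by simp
qed

text \<open>Smooth sections through given vectors are available for D1 and D2. Their sum is
  orthogonal, so the vertical projection is the sum of the two smooth projections.\<close>

lemma smooth_hor:
  assumes E: "field E" shows "field (hor M N \<pi> E)"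
proof -
  define E1 where "E1 p = orth_proj (g p) (D1 p) (E p)" for p
  define E2 where "E2 p = orth_proj (g p) (D2 p) (E p)" for p
  have "ver M N \<pi> E p = E1 p + E2 p" for p
    unfolding ver_def
  proof (rule orth_proj_unique[OF M.metric subspace_vertical])
    note D1 = orth_proj[OF M.metric subspace(1)]
      and D2 = orth_proj[OF M.metric subspace(2)]
    show "E1 p + E2 p \<in> vert p" unfolding vertical_eq E1_def E2_def by (blast intro: D1(1) D2(1))
    fix u assume "u \<in> vert p"
    then obtain x y where xy: "x \<in> D1 p" "y \<in> D2 p" "u = x + y" by (auto simp: vertical_eq)
    then have "g p (E p - E1 p) x = 0" "g p (E p - E2 p) y = 0" "g p (E1 p) y = 0" "g p (E2 p) x = 0"
      using D1 D2 D1_orth_D2 g_sym[of p "E2 p" x] by (simp_all add: E1_def E2_def)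
    then show "g p (E p - (E1 p + E2 p)) u = 0" using xy(3) by (simp add: g_simps)
  qed
  then have "hor M N \<pi> E = (\<lambda>p. E p - E1 p - E2 p)" by (simp add: fun_eq_iff hor_eq)
  moreover have "field E1" "field E2"
    unfolding E1_def E2_def by (rule M.smooth_field_orth_proj[OF _ E] distribution)+
  ultimately show ?thesis using E by (simp add: M.smooth_field_diff)
qed

lemma smooth_ver:
  assumes E: "field E" shows "field (ver M N \<pi> E)"
proof -
  have "ver M N \<pi> E = (\<lambda>p. E p - hor M N \<pi> E p)" by (simp add: fun_eq_iff hor_eq)
  then show ?thesis using M.smooth_field_diff[OF E smooth_hor[OF E]] by simp
qed

section \<open>The operators P and F on the slant distributions\<close>

lemma smooth_P_part: "field V \<Longrightarrow> field (P_part M N \<pi> J V)"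
  and smooth_F_part: "field V \<Longrightarrow> field (F_part M N \<pi> J V)"
  unfolding P_part_def F_part_def
  using smooth_ver smooth_hor M.smooth_field_endo[OF J_smooth] by blast+

lemma P_vertical: "P_part M N \<pi> J V p \<in> vert p"
  and F_horizontal: "F_part M N \<pi> J V p \<in> horizontal M N \<pi> p"
  unfolding P_part_def F_part_def by (rule ver_vertical hor_horizontal)+

lemma P_plus_F: "P_part M N \<pi> J V p + F_part M N \<pi> J V p = J p (V p)"
  by (simp add: P_part_def F_part_def hor_eq)

lemma metric_P: "v \<in> vert p \<Longrightarrow> g p (P_part M N \<pi> J V p) v = g p (J p (V p)) v"
  unfolding P_part_def by (rule metric_ver)

lemma P_D1:
  assumes "V p \<in> D1 p" shows "P_part M N \<pi> J V p \<in> D1 p"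
  by (rule vertical_in_D1[OF P_vertical]) (simp add: metric_P[OF D2_vertical] J_orth[OF assms])

lemma P_D2_orth_D1:
  assumes "U p \<in> D2 p" "x \<in> D1 p" shows "g p (P_part M N \<pi> J U p) x = 0"
  using J_orth[OF assms(2,1)] J_skew[of p "U p" x] g_sym[of p "U p" "J p x"]
  by (simp add: metric_P[OF D1_vertical[OF assms(2)]])

text \<open>g(FU,FY) is g(JU,JY) - g(PU,PY). The first term is g(U,Y) = 0; in the second, PY stays
  in D1 while PU is orthogonal to D1.\<close>

lemma F_D1_orth_F_D2:
  assumes "Y p \<in> D1 p" "U p \<in> D2 p"
  shows "g p (F_part M N \<pi> J U p) (F_part M N \<pi> J Y p) = 0"
proof -
  have F: "F_part M N \<pi> J V p = J p (V p) - P_part M N \<pi> J V p" for V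
    using P_plus_F[of V p] by (simp add: algebra_simps)
  have "g p (F_part M N \<pi> J U p) (F_part M N \<pi> J Y p) =
      g p (F_part M N \<pi> J U p) (J p (Y p)) - g p (F_part M N \<pi> J U p) (P_part M N \<pi> J Y p)"
    by (simp add: F[of Y] g_simps)
  also have "\<dots> = g p (U p) (Y p) - g p (P_part M N \<pi> J U p) (J p (Y p))"
    unfolding horizontal_vertical[OF F_horizontal P_vertical] by (simp add: F[of U] g_simps J_isometry)
  also have "g p (P_part M N \<pi> J U p) (J p (Y p)) = g p (P_part M N \<pi> J U p) (P_part M N \<pi> J Y p)"
    using metric_P[OF P_vertical, of p Y U] g_sym by metis
  finally show ?thesis
    using P_D2_orth_D1[of U p, OF assms(2) P_D1[of Y p, OF assms(1)]] D1_orth_D2[OF assms] g_sym[of p "U p" "Y p"]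
    by simp
qed

text \<open>Because P preserves D1, PY is the projection of JY to D1, so the cosine of the slant
  angle is the length of PY divided by that of Y.\<close>

lemma P_D1_length:
  assumes Y: "Y p \<in> D1 p"
  shows "g p (P_part M N \<pi> J Y p) (P_part M N \<pi> J Y p) = (cos \<theta>\<^sub>1)\<^sup>2 * g p (Y p) (Y p)"
    and "Y p \<noteq> 0 \<Longrightarrow> \<theta>\<^sub>1 \<noteq> 0 \<Longrightarrow> (cos \<theta>\<^sub>1)\<^sup>2 \<noteq> 1"
proof -
  let ?P = "P_part M N \<pi> J Y p" and ?F = "F_part M N \<pi> J Y p"
  have proj: "orth_proj (g p) (D1 p) (J p (Y p)) = ?P"
    by (rule orth_proj_unique[OF M.metric subspace(1) P_D1[of Y p, OF Y]])
       (simp add: g_simps metric_P[OF D1_vertical])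
  have nonneg: "g p v v \<ge> 0" for v
    using inner_formD(3)[OF M.metric, of v p] by (cases "v = 0") (auto simp: g_simps intro: less_imp_le)
  have "g p (Y p) (Y p) = g p (?P + ?F) (?P + ?F)" by (simp add: P_plus_F J_isometry)
  also have "\<dots> = g p ?P ?P + g p ?F ?F"
    using horizontal_vertical[OF F_horizontal P_vertical, of p Y Y] g_sym[of p ?P ?F]
    by (simp add: g_simps)
  finally have le: "g p ?P ?P \<le> g p (Y p) (Y p)" using nonneg[of ?F] by simp
  define r where "r = sqrt (g p ?P ?P) / sqrt (g p (Y p) (Y p))"
  have *: "g p ?P ?P = (cos \<theta>\<^sub>1)\<^sup>2 * g p (Y p) (Y p) \<and> (\<theta>\<^sub>1 \<noteq> 0 \<longrightarrow> (cos \<theta>\<^sub>1)\<^sup>2 \<noteq> 1)" if "Y p \<noteq> 0"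
  proof -
    have pos: "g p (Y p) (Y p) > 0" using inner_formD(3)[OF M.metric that] .
    have "angle_to (g p) (J p (Y p)) (D1 p) = \<theta>\<^sub>1"
      using bi_slant that Y by (simp add: bi_slant_submersion_def slant_def)
    then have \<theta>: "\<theta>\<^sub>1 = arccos r" by (simp add: angle_to_def proj J_isometry r_def)
    \<comment> \<open>By Pythagoras PY is no longer than JY, hence than Y; this puts the quotient in
      the range where cos inverts arccos.\<close>
    have r: "0 \<le> r" "r \<le> 1" using le nonneg pos by (simp_all add: r_def)
    then have cos: "cos \<theta>\<^sub>1 = r" by (simp add: \<theta>)
    have "r\<^sup>2 * g p (Y p) (Y p) = g p ?P ?P"
      using pos nonneg by (simp add: r_def power_divide)
    moreover have "\<theta>\<^sub>1 = 0" if "r\<^sup>2 = 1" using that r \<theta> by (simp add: power2_eq_1_iff)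
    ultimately show ?thesis by (auto simp: cos)
  qed
  then show "Y p \<noteq> 0 \<Longrightarrow> \<theta>\<^sub>1 \<noteq> 0 \<Longrightarrow> (cos \<theta>\<^sub>1)\<^sup>2 \<noteq> 1" by blast
  \<comment> \<open>The slant condition is silent about the zero vector, where the length estimate
    takes over.\<close>
  have "?P = 0" if "Y p = 0"
    using le that nonneg[of ?P] inner_formD(4)[OF M.metric] by (simp add: g_simps)
  with * show "g p ?P ?P = (cos \<theta>\<^sub>1)\<^sup>2 * g p (Y p) (Y p)"
    by (cases "Y p = 0") (simp_all add: g_simps)
qed

text \<open>Polarization of \<open>P_D1_length\<close>; \<open>P\<close> is skew on vertical vectors.\<close>

lemma P_P_D1:
  assumes Y: "Y p \<in> D1 p"
  shows "P_part M N \<pi> J (P_part M N \<pi> J Y) p = - ((cos \<theta>\<^sub>1)\<^sup>2 *\<^sub>R Y p)"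
proof -
  \<comment> \<open>P acts point by point, so it restricts to a map of the tangent space at
    \<open>p\<close>; the family \<open>\<lambda>q. v\<close> need not be a smooth field.\<close>
  define Q where "Q v = P_part M N \<pi> J (\<lambda>q. v) p" for v
  have Q_eq: "P_part M N \<pi> J V p = Q (V p)" for V by (simp add: Q_def P_part_def ver_def)
  have Qv: "Q v \<in> vert p" for v unfolding Q_def by (rule P_vertical)
  have gQ: "g p (Q v) w = g p (J p v) w" if "w \<in> vert p" for v w
    unfolding Q_def by (rule metric_P[OF that])
  have QD1: "Q v \<in> D1 p" if "v \<in> D1 p" for v
    unfolding Q_def by (rule P_D1) (rule that)
  have Qlen: "g p (Q v) (Q v) = (cos \<theta>\<^sub>1)\<^sup>2 * g p v v" if "v \<in> D1 p" for v
    unfolding Q_def by (rule P_D1_length(1)) (rule that)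
  define b where "b v w = g p (Q v) (Q w) - (cos \<theta>\<^sub>1)\<^sup>2 * g p v w" for v w
  define y where "y = Y p"
  \<comment> \<open>The defect of the claim. It lies in D1, so it suffices that it is orthogonal to
    itself.\<close>
  define z where "z = Q (Q y) + (cos \<theta>\<^sub>1)\<^sup>2 *\<^sub>R y"
  have y: "y \<in> D1 p" using Y by (simp add: y_def)
  have z: "z \<in> D1 p"
    unfolding z_def by (intro subspace_add subspace_scale subspace QD1 y)
  have Qadd: "Q (v + w) = Q v + Q w" for v w
    unfolding Q_def P_part_def ver_def
  proof (rule orth_proj_unique[OF M.metric subspace_vertical])
    note proj = orth_proj[OF M.metric subspace_vertical]
    show "orth_proj (g p) (vert p) (J p v) + orth_proj (g p) (vert p) (J p w) \<in> vert p"
      by (intro subspace_add[OF subspace_vertical] proj(1))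
    show "g p (J p (v + w) - (orth_proj (g p) (vert p) (J p v) + orth_proj (g p) (vert p) (J p w))) u = 0"
      if "u \<in> vert p" for u
      using proj(2)[OF that, of p "J p v"] proj(2)[OF that, of p "J p w"]
      by (simp add: linear_add[OF J_linear] g_simps)
  qed
  \<comment> \<open>Polarization: comparing lengths at \<open>y\<close>, \<open>z\<close> and
    \<open>y + z\<close> leaves the mixed term.\<close>
  have "g p (Q (y + z)) (Q (y + z)) = (cos \<theta>\<^sub>1)\<^sup>2 * g p (y + z) (y + z)"
    by (intro Qlen subspace_add[OF subspace(1)] y z)
  then have "g p (Q y) (Q z) = (cos \<theta>\<^sub>1)\<^sup>2 * g p y z"
    using Qlen[OF y] Qlen[OF z] g_sym[of p "Q z" "Q y"] g_sym[of p z y]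
    by (simp add: Qadd g_simps algebra_simps)
  moreover have "g p (Q (Q y)) z = - g p (Q y) (Q z)"
    using gQ[OF D1_vertical[OF z], of "Q y"] gQ[OF Qv, of z y] J_skew[of p "Q y" z]
      g_sym[of p "Q y" "J p z"] g_sym[of p "Q z" "Q y"] by simp
  ultimately have "g p z z = 0"
    by (subst z_def) (simp add: g_simps)
  then have "z = 0" using inner_formD(4)[OF M.metric] by blast
  then show ?thesis
    by (simp add: Q_eq y_def[symmetric] z_def add_eq_0_iff2)
qed

text \<open>Both sides depend on \<open>Y\<close> only through \<open>Y p\<close>, which is why it is enough that every vector
  of \<open>D1\<close> extends to a section \<open>Y\<close> with \<open>F Y\<close> basic near \<open>p\<close>.\<close>

lemma F_part_basic_derivative:
  assumes Y: "section_of M D1 Y" "basic_on M N \<pi> W (F_part M N \<pi> J Y)" "open W" "p \<in> W"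
    and X: "section_of M D1 X" and U: "section_of M D2 U"
  shows "g p (F_part M N \<pi> J Y p) (nabla (F_part M N \<pi> J U) X p) =
    g p (F_part M N \<pi> J Y p) (nabla X (F_part M N \<pi> J U) p)"
proof -
  have sec: "field X" "\<And>q. X q \<in> D1 q" "field U" "\<And>q. U q \<in> D2 q" "field Y" "\<And>q. Y q \<in> D1 q"
    using X U Y(1) by (simp_all add: section_of_def)
  \<comment> \<open>Here FY being basic trades the derivative along FU for one along X. The next
    step moves it from FY onto FU, using that FU and FY are orthogonal everywhere.\<close>
  have "g p (F_part M N \<pi> J Y p) (nabla (F_part M N \<pi> J U) X p) =
      - g p (F_part M N \<pi> J U p) (nabla X (F_part M N \<pi> J Y) p)"
    using nabla_horizontal_basic[OF sec(1) D1_vertical[OF sec(2)] smooth_F_part[OF sec(3)] F_horizontal Y(2-4)]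
      g_sym by simp
  also have "\<dots> = g p (nabla X (F_part M N \<pi> J U) p) (F_part M N \<pi> J Y p)"
    using nabla_skew[OF sec(1) smooth_F_part[OF sec(3)] smooth_F_part[OF sec(5)]
        F_D1_orth_F_D2[of Y _ U, OF sec(6) sec(4)]] by simp
  finally show ?thesis using g_sym by metis
qed

text \<open>The factor is the squared sine of the first slant angle. An identity, rather than an
  equivalence, yields both directions of the theorem at once.\<close>

lemma oneill_identity:
  assumes basic: "basic_convention M N \<pi> J D1"
    and X: "section_of M D1 X" and Y: "section_of M D1 Y" and U: "section_of M D2 U"
  shows "g p (oneill_T M N \<pi> nabla (P_part M N \<pi> J U) (F_part M N \<pi> J Y) p
      - oneill_T M N \<pi> nabla U (F_part M N \<pi> J (P_part M N \<pi> J Y)) p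
      + oneill_A M N \<pi> nabla (F_part M N \<pi> J U) (F_part M N \<pi> J Y) p) (X p) =
    (1 - (cos \<theta>\<^sub>1)\<^sup>2) * g p (nabla X Y p) (U p)"
proof -
  let ?P = "P_part M N \<pi> J" and ?F = "F_part M N \<pi> J"
  have sec: "field X" "\<And>q. X q \<in> D1 q" "field U" "\<And>q. U q \<in> D2 q" "field Y" "\<And>q. Y q \<in> D1 q"
    using X U Y by (simp_all add: section_of_def)
  note vX = D1_vertical[OF sec(2)] and vU = D2_vertical[OF sec(4)]
  note smooth = sec(1,3,5) smooth_P_part[OF sec(3)] smooth_F_part[OF sec(3)]
    smooth_F_part[OF sec(5)] smooth_F_part[OF smooth_P_part[OF sec(5)]]
  have skew: "g p (nabla E (?F V) p) (X p) = - g p (?F V p) (nabla E X p)"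
    if "field E" "field (?F V)" for E V
    by (rule nabla_horizontal_vertical_skew[OF that F_horizontal sec(1) vX])
  \<comment> \<open>The two derivatives differ by a bracket of vertical fields, which is vertical
    and hence orthogonal to the horizontal FV.\<close>
  have swap: "g p (?F V p) (nabla Z X p) = g p (?F V p) (nabla X Z p)"
    if "field Z" "\<And>q. Z q \<in> vert q" for V Z
    using horizontal_vertical[OF F_horizontal bracket_vertical[OF that sec(1) vX], of p V]
    by (simp add: g_simps)
  \<comment> \<open>F acts point by point, so Y may be replaced by a section with the same value at
    p and with a basic image under F nearby.\<close>
  have F_value: "?F V p = ?F V' p" if "V p = V' p" for V V'
    using that by (simp add: F_part_def hor_def)
  have "\<exists>Y' W. section_of M D1 Y' \<and> Y' p = Y p \<and> open W \<and> p \<in> W \<and> basic_on M N \<pi> W (?F Y')"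
    using basic sec(6) unfolding basic_convention_def by blast
  then obtain Y' W where Y': "section_of M D1 Y'" "Y' p = Y p" "open W" "p \<in> W" "basic_on M N \<pi> W (?F Y')"
    by blast
  have A: "g p (?F Y p) (nabla (?F U) X p) = g p (?F Y p) (nabla X (?F U) p)"
    using F_part_basic_derivative[OF Y'(1,5,3,4) X U] unfolding F_value[of Y' Y, OF Y'(2)] .
  \<comment> \<open>The derivatives of PU and FU along X recombine into that of JU, where
    parallelism of J applies.\<close>
  have "nabla X (\<lambda>q. J q (U q)) p = nabla X (?P U) p + nabla X (?F U) p"
    unfolding P_plus_F[symmetric] by (rule nabla_add) (rule smooth)+
  then have J: "nabla X (?P U) p + nabla X (?F U) p = J p (nabla X U p)"
    by (simp add: nabla_J[OF sec(1,3)])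
  have "g p (oneill_T M N \<pi> nabla (?P U) (?F Y) p - oneill_T M N \<pi> nabla U (?F (?P Y)) p
      + oneill_A M N \<pi> nabla (?F U) (?F Y) p) (X p) =
    g p (nabla (?P U) (?F Y) p) (X p) - g p (nabla U (?F (?P Y)) p) (X p)
      + g p (nabla (?F U) (?F Y) p) (X p)"
    by (simp add: g_simps metric_oneill_T[OF vX] metric_oneill_A[OF vX] ver_vertical_field[OF P_vertical]
        ver_vertical_field[OF vU] hor_horizontal_field[OF F_horizontal])
  also have "\<dots> = - g p (?F Y p) (nabla X (?P U) p) + g p (?F (?P Y) p) (nabla X U p)
      - g p (?F Y p) (nabla X (?F U) p)"
    using skew[OF smooth(4,6)] skew[OF smooth(2,7)] skew[OF smooth(5,6)] A
      swap[OF smooth(4) P_vertical, of Y] swap[OF smooth(2) vU, of "?P Y"] by simp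
  also have "\<dots> = g p (J p (?F Y p) + ?F (?P Y) p) (nabla X U p)"
    by (simp add: g_simps J_skew J[symmetric])
  \<comment> \<open>J FY = J(JY - PY) = -Y - PPY - FPY, so the FPY terms cancel and
    \<open>P_P_D1\<close> evaluates PPY.\<close>
  also have "J p (?F Y p) + ?F (?P Y) p = - ((1 - (cos \<theta>\<^sub>1)\<^sup>2) *\<^sub>R Y p)"
  proof -
    have "J p (?F Y p) = J p (J p (Y p)) - J p (?P Y p)"
      unfolding linear_diff[OF J_linear, symmetric] P_plus_F[of Y p, symmetric] by simp
    also have "\<dots> = - Y p - (?P (?P Y) p + ?F (?P Y) p)" by (simp add: J_J P_plus_F)
    finally show ?thesis by (simp add: P_P_D1[of Y p, OF sec(6)] algebra_simps)
  qed
  also have "g p (- ((1 - (cos \<theta>\<^sub>1)\<^sup>2) *\<^sub>R Y p)) (nabla X U p) =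
      (1 - (cos \<theta>\<^sub>1)\<^sup>2) * g p (nabla X Y p) (U p)"
    using nabla_skew[OF sec(1,5,3) D1_orth_D2[OF sec(6,4)]] by (simp add: g_simps)
  finally show ?thesis .
qed

text \<open>A vertical vector lies in D1 exactly when it is orthogonal to D2, and every vector of D2
  is a value of a section, so sections suffice as test objects.\<close>

lemma totally_geodesic_iff:
  "totally_geodesic_on_kernel M N \<pi> nabla D1 \<longleftrightarrow>
    (\<forall>X Y U. section_of M D1 X \<longrightarrow> section_of M D1 Y \<longrightarrow> section_of M D2 U \<longrightarrow>
      (\<forall>p. g p (nabla X Y p) (U p) = 0))"
proof -
  have "ver M N \<pi> E p \<in> D1 p \<longleftrightarrow> (\<forall>U. section_of M D2 U \<longrightarrow> g p (E p) (U p) = 0)" for E p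
  proof (intro iffI allI impI)
    fix U assume "ver M N \<pi> E p \<in> D1 p" "section_of M D2 U"
    then show "g p (E p) (U p) = 0"
      using D1_orth_D2 metric_ver[OF D2_vertical] by (metis section_of_def)
  next
    assume *: "\<forall>U. section_of M D2 U \<longrightarrow> g p (E p) (U p) = 0"
    show "ver M N \<pi> E p \<in> D1 p"
    proof (rule vertical_in_D1[OF ver_vertical])
      fix u assume u: "u \<in> D2 p"
      then obtain U where "section_of M D2 U" "U p = u"
        using distribution(2) unfolding distribution_def by blast
      then show "g p (ver M N \<pi> E p) u = 0" using * metric_ver[OF D2_vertical[OF u]] by auto
    qed
  qed
  then show ?thesis
    unfolding totally_geodesic_on_kernel_def nabla_hat_def by metis
qed

end

theorem theorem3p9:
  fixes M :: "('m::{t2_space, second_countable_topology}, 'e::euclidean_space) riem"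
    and N :: "('n::{t2_space, second_countable_topology}, 'f::euclidean_space) riem"
    and nabla :: "('m \<Rightarrow> 'e) \<Rightarrow> ('m \<Rightarrow> 'e) \<Rightarrow> ('m \<Rightarrow> 'e)"
    and J :: "'m \<Rightarrow> 'e \<Rightarrow> 'e"
    and \<pi> :: "'m \<Rightarrow> 'n"
    and D1 D2 :: "'m \<Rightarrow> 'e set"
    and \<theta>\<^sub>1 \<theta>\<^sub>2 :: real
  assumes bi_slant: "bi_slant_submersion M N nabla J \<pi> D1 D2 \<theta>\<^sub>1 \<theta>\<^sub>2"
    and proper: "proper_angles \<theta>\<^sub>1 \<theta>\<^sub>2"
    and J_orth: "\<And>p x u. x \<in> D1 p \<Longrightarrow> u \<in> D2 p \<Longrightarrow> rmetric M p (J p x) u = 0"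
    and basic: "basic_convention M N \<pi> J D1"
  shows "totally_geodesic_on_kernel M N \<pi> nabla D1 \<longleftrightarrow>
    (\<forall>X Y U. section_of M D1 X \<longrightarrow> section_of M D1 Y \<longrightarrow> section_of M D2 U \<longrightarrow>
      (\<forall>p. rmetric M p
         (oneill_T M N \<pi> nabla (P_part M N \<pi> J U) (F_part M N \<pi> J Y) p
          - oneill_T M N \<pi> nabla U (F_part M N \<pi> J (P_part M N \<pi> J Y)) p
          + oneill_A M N \<pi> nabla (F_part M N \<pi> J U) (F_part M N \<pi> J Y) p)
         (X p) = 0))"
proof -
  interpret bi_slant M N nabla J \<pi> D1 D2 \<theta>\<^sub>1 \<theta>\<^sub>2
    using bi_slant J_orth by unfold_locales
  have "(1 - (cos \<theta>\<^sub>1)\<^sup>2) * g p (nabla X Y p) (U p) = 0 \<longleftrightarrow> g p (nabla X Y p) (U p) = 0"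
    if X: "section_of M D1 X" and Y: "section_of M D1 Y" and U: "section_of M D2 U" for X Y U p
  proof (cases "Y p = 0")
    \<comment> \<open>\<open>P_D1_length\<close> excludes a squared cosine of 1 only in the presence
      of a nonzero vector of D1. Where Y vanishes, both sides are zero because Y and U are
      orthogonal everywhere.\<close>
    case True
    then have "g p (nabla X Y p) (U p) = 0"
      using nabla_skew[of X Y U p] X Y U D1_orth_D2 by (simp add: section_of_def g_simps)
    then show ?thesis by simp
  next
    case False
    then show ?thesis
      using P_D1_length(2)[of Y p] Y proper by (simp add: section_of_def proper_angles_def)
  qed
  then show ?thesis
    unfolding totally_geodesic_iff by (simp add: oneill_identity[OF basic] cong: imp_cong)
qed

end
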